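(* Let $a>0$, $b>0$, $c>0$ and put $\Phi(x)={}_1F_2\left(a\,;b,c\,;-\frac{x^2}{4}\right)$ for $x>0$. If $(a,b,c)\in\mathcal{P}_{1,2}$, then necessarily $b>a$, $c>a$ and $b+c\ge 3a+\frac12$. Moreover: (i) If $0<b\le a$, then $\Phi$ alternates in sign and has at least one zero on the interval $(0,j_{c-1}]$; if $0<c\le a$, then $\Phi$ alternates in sign and has at least one zero on $(0,j_{b-1}]$. (ii) Suppose that either ($b\le a+\frac12$ and $c\le 2a$) or ($b\le 2a$ and $c\le a+\frac12$), and in addition $b+c<3a+\frac12$. Then $\Phi$ alternates in sign and has at least one zero on the interval $\left(0,\,2j_{a-\frac12}\right)$.
   Context: For $a,b,c>0$, ${}_1F_2\left(a\,;b,c\,;-\frac{x^2}{4}\right)=\sum_{k=0}^\infty \frac{(a)_k}{k!\,(b)_k(c)_k}\left(-\frac{x^2}{4}\right)^k$, where $(\alpha)_k=\Gamma(\alpha+k)/\Gamma(\alpha)$. $\mathcal{P}_{1,2}$ denotes the set of all triples $(a,b,c)$ of positive reals such that this function is $>0$ for all $x>0$. For $\alpha>-1$, $j_\alpha$ denotes the smallest positive zero of the Bessel function $J_\alpha$. "$\Phi$ alternates in sign" means that $\Phi$ takes both positive and negative values on $(0,\infty)$. *)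

theory Defs
  imports "HOL-Analysis.Analysis"
begin

definition hyp1F2 :: "real \<Rightarrow> real \<Rightarrow> real \<Rightarrow> real \<Rightarrow> real" where
  "hyp1F2 a b c z = (\<Sum>k. pochhammer a k / (fact k * pochhammer b k * pochhammer c k) * z ^ k)"

definition Phi :: "real \<Rightarrow> real \<Rightarrow> real \<Rightarrow> real \<Rightarrow> real" where
  "Phi a b c x = hyp1F2 a b c (- (x^2) / 4)"

definition P12 :: "(real \<times> real \<times> real) set" where
  "P12 = {(a, b, c). a > 0 \<and> b > 0 \<and> c > 0 \<and> (\<forall>x>0. Phi a b c x > 0)}"

text \<open>Bessel function of the first kind, for x > 0 and alpha > -1:
  J_alpha(x) = sum_k (-1)^k / (k! Gamma(k+alpha+1)) (x/2)^(2k+alpha).\<close>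
definition BesselJ :: "real \<Rightarrow> real \<Rightarrow> real" where
  "BesselJ \<alpha> x = (\<Sum>k. (-1) ^ k / (fact k * Gamma (real k + \<alpha> + 1)) * (x / 2) powr (2 * real k + \<alpha>))"

definition bessel_zero :: "real \<Rightarrow> real" where
  "bessel_zero \<alpha> = (LEAST x. x > 0 \<and> BesselJ \<alpha> x = 0)"

definition alternates :: "(real \<Rightarrow> real) \<Rightarrow> bool" where
  "alternates f \<longleftrightarrow> (\<exists>x>0. f x > 0) \<and> (\<exists>x>0. f x < 0)"

end

theory Submission
  imports Defs "HOL-Complex_Analysis.Complex_Analysis" "HOL-Real_Asymp.Real_Asymp"
begin

text \<open>
  Raising a lower parameter of \<open>1F2\<close> averages \<open>\<Phi>\<close> against a Beta density. Hence, if \<open>\<Phi>\<close> is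
  nonnegative on \<open>(0, x)\<close>, the function with a larger lower parameter is strictly positive at \<open>x\<close>.
  For \<open>b \<le> a\<close> one raises \<open>b\<close> to \<open>a\<close>, where \<open>\<Phi>\<close> is a multiple of \<open>J\<^bsub>c-1\<^esub>\<close>; in the second case one
  raises \<open>(b, c)\<close> to \<open>(a + 1/2, 2a)\<close>, where \<open>\<Phi>(x)\<close> is a multiple of \<open>J\<^bsub>a-1/2\<^esub>(x/2)\<^sup>2\<close>. Bessel zeros exist
  by Rolle's theorem starting from the cosine at half-integer parameters, and by averaging in general.

  For \<open>b + c \<ge> 3a + 1/2\<close> let \<open>\<Phi> \<ge> 0\<close>, \<open>g(x) = x\<^bsup>2b-1\<^esup> \<Phi>(x)\<close> and let \<open>L\<close> be the Laplace transform of \<open>g\<close>.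
  The Gaussian averages of \<open>g\<close> are values of \<open>1F1(a; c; -y)\<close>, which decays like \<open>y\<^bsup>-a\<^esup>\<close>; this yields
  \<open>L(\<sigma>) = O(\<sigma>\<^bsup>2a-2b\<^esup>)\<close> as \<open>\<sigma>\<close> tends to 0. On the other hand
  \<open>L(p) = \<Gamma>(2b) p\<^bsup>-2b\<^esup> 2F1(a, b + 1/2; c; -1/p\<^sup>2)\<close> blows up like \<open>|p - \<i>|\<^bsup>c-a-b-1/2\<^esup>\<close> at \<open>p = \<i>\<close>. Since
  \<open>|L(p)| \<le> L(Re p)\<close>, comparing the exponents gives the inequality.
\<close>

subsection \<open>Termwise integration and averaging over a lower parameter\<close>

text \<open>Extending every term by zero outside \<open>S\<close> reduces this to termwise Lebesgue
  integration on the whole space; the result is then carried back to the gauge integral.\<close>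

lemma has_integral_suminf:
  fixes f :: "nat \<Rightarrow> 'a::euclidean_space \<Rightarrow> real"
  assumes f: "\<And>n. f n absolutely_integrable_on S"
    and pointwise: "\<And>x. x \<in> S \<Longrightarrow> summable (\<lambda>n. \<bar>f n x\<bar>)"
    and norms: "summable (\<lambda>n. integral S (\<lambda>x. \<bar>f n x\<bar>))"
  shows "(\<lambda>x. \<Sum>n. f n x) absolutely_integrable_on S"
    and "((\<lambda>x. \<Sum>n. f n x) has_integral (\<Sum>n. integral S (f n))) S"
proof -
  define g where "g = (\<lambda>n x. indicat_real S x *\<^sub>R f n x)"
  have int: "integrable lebesgue (g n)" for n
    using f[of n] unfolding g_def set_integrable_def .
  have AE: "AE x in lebesgue. summable (\<lambda>n. norm (g n x))"
  proof (rule AE_I2)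
    show "summable (\<lambda>n. norm (g n x))" for x
      using pointwise[of x] by (cases "x \<in> S") (auto simp: g_def)
  qed
  have eq: "integral\<^sup>L lebesgue (\<lambda>x. norm (g n x)) = integral S (\<lambda>x. \<bar>f n x\<bar>)" for n
  proof -
    have "(\<lambda>x. \<bar>f n x\<bar>) absolutely_integrable_on S"
      using set_integrable_norm[OF f[of n]] by simp
    from set_lebesgue_integral_eq_integral(2)[OF this] show ?thesis
      by (simp add: g_def set_lebesgue_integral_def abs_mult)
  qed
  have eq': "integral\<^sup>L lebesgue (g n) = integral S (f n)" for n
    using set_lebesgue_integral_eq_integral(2)[OF f[of n]]
    by (simp add: g_def set_lebesgue_integral_def)
  have sm: "summable (\<lambda>n. integral\<^sup>L lebesgue (\<lambda>x. norm (g n x)))"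
    using norms by (simp only: eq)
  have sum_g: "(\<Sum>n. g n x) = indicat_real S x *\<^sub>R (\<Sum>n. f n x)" for x
    by (cases "x \<in> S") (auto simp: g_def)
  have "integrable lebesgue (\<lambda>x. \<Sum>n. g n x)"
    by (rule integrable_suminf[OF int AE sm])
  then show abs: "(\<lambda>x. \<Sum>n. f n x) absolutely_integrable_on S"
    by (simp add: sum_g set_integrable_def)
  have "integral\<^sup>L lebesgue (\<lambda>x. \<Sum>n. g n x) = (\<Sum>n. integral S (f n))"
    using integral_suminf[OF int AE sm] by (simp add: eq')
  then have "integral S (\<lambda>x. \<Sum>n. f n x) = (\<Sum>n. integral S (f n))"
    using set_lebesgue_integral_eq_integral(2)[OF abs]
    by (simp add: sum_g set_lebesgue_integral_def)
  then show "((\<lambda>x. \<Sum>n. f n x) has_integral (\<Sum>n. integral S (f n))) S"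
    using abs by (metis absolutely_integrable_on_def integrable_integral)
qed

text \<open>Since \<open>w\<close> and \<open>\<phi>\<close> are nonnegative, \<open>I n\<close> is
  also the absolute moment, so one numerical series justifies the exchange. It serves Beta weights
  with \<open>\<phi>\<close> the identity, and Gaussian and exponential weights with
  \<open>\<phi>\<close> the square.\<close>

lemma has_integral_powser:
  fixes w \<phi> :: "'a::euclidean_space \<Rightarrow> real" and c I :: "nat \<Rightarrow> real"
  assumes nonneg: "\<And>x. x \<in> S \<Longrightarrow> 0 \<le> w x" "\<And>x. x \<in> S \<Longrightarrow> 0 \<le> \<phi> x"
    and moments: "\<And>n. ((\<lambda>x. w x * \<phi> x ^ n) has_integral I n) S"
    and norms: "summable (\<lambda>n. \<bar>c n\<bar> * I n)"
    and pointwise: "\<And>x. x \<in> S \<Longrightarrow> summable (\<lambda>n. \<bar>c n * \<phi> x ^ n\<bar>)"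
  shows "(\<lambda>x. w x * (\<Sum>n. c n * \<phi> x ^ n)) absolutely_integrable_on S"
    and "((\<lambda>x. w x * (\<Sum>n. c n * \<phi> x ^ n)) has_integral (\<Sum>n. c n * I n)) S"
proof -
  define f where "f = (\<lambda>n x. c n * (w x * \<phi> x ^ n))"
  have f_int: "(f n has_integral c n * I n) S" for n
    unfolding f_def by (rule has_integral_mult_right[OF moments])
  have f_abs: "((\<lambda>x. \<bar>f n x\<bar>) has_integral \<bar>c n\<bar> * I n) S" for n
    using has_integral_mult_right[OF moments[of n], of "\<bar>c n\<bar>"]
    by (rule has_integral_eq[rotated]) (use nonneg in \<open>simp add: f_def abs_mult\<close>)
  have 1: "f n absolutely_integrable_on S" for n
    using f_int[of n] f_abs[of n] by (auto simp: absolutely_integrable_on_def)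
  have 2: "summable (\<lambda>n. \<bar>f n x\<bar>)" if "x \<in> S" for x
    using summable_mult[OF pointwise[OF that], of "\<bar>w x\<bar>"]
    by (simp add: f_def abs_mult mult_ac)
  have 3: "summable (\<lambda>n. integral S (\<lambda>x. \<bar>f n x\<bar>))"
    using norms by (simp add: integral_unique[OF f_abs])
  have eq: "(\<Sum>n. f n x) = w x * (\<Sum>n. c n * \<phi> x ^ n)" if "x \<in> S" for x
    using suminf_mult[OF summable_rabs_cancel[OF pointwise[OF that]], of "w x"]
    by (simp add: f_def mult_ac)
  show "(\<lambda>x. w x * (\<Sum>n. c n * \<phi> x ^ n)) absolutely_integrable_on S"
    using has_integral_suminf(1)[OF 1 2 3] by (rule set_integrable_cong[THEN iffD1, rotated -1]) (simp_all add: eq)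
  have "((\<lambda>x. \<Sum>n. f n x) has_integral (\<Sum>n. c n * I n)) S"
    using has_integral_suminf(2)[OF 1 2 3] by (simp add: integral_unique[OF f_int])
  then show "((\<lambda>x. w x * (\<Sum>n. c n * \<phi> x ^ n)) has_integral (\<Sum>n. c n * I n)) S"
    by (rule has_integral_eq[rotated]) (simp add: eq)
qed

section \<open>The power series of 1F2: convergence and continuity\<close>

definition hyp1F2_coeff :: "real \<Rightarrow> real \<Rightarrow> real \<Rightarrow> nat \<Rightarrow> real" where
  "hyp1F2_coeff a b c k = pochhammer a k / (fact k * pochhammer b k * pochhammer c k)"

lemma hyp1F2_coeff_commute: "hyp1F2_coeff a b c = hyp1F2_coeff a c b"
  by (simp add: hyp1F2_coeff_def fun_eq_iff mult_ac)

lemma hyp1F2_eq: "hyp1F2 a b c z = (\<Sum>k. hyp1F2_coeff a b c k * z ^ k)"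
  by (simp add: hyp1F2_def hyp1F2_coeff_def)

lemma Phi_commute: "Phi a b c = Phi a c b"
  by (simp add: Phi_def hyp1F2_eq hyp1F2_coeff_commute fun_eq_iff)

text \<open>The ratio enters as a multiplier \<open>q\<close> rather than a quotient of terms, so
  terms may vanish, as they do for a power series at 0.\<close>

lemma summable_abs_by_ratio:
  fixes f :: "nat \<Rightarrow> real"
  assumes "\<And>k. f (Suc k) = q k * f k" and "q \<longlonglongrightarrow> l" and "\<bar>l\<bar> < 1"
  shows "summable (\<lambda>k. \<bar>f k\<bar>)"
proof -
  obtain r where r: "\<bar>l\<bar> < r" "r < 1"
    using assms(3) dense by blast
  have "eventually (\<lambda>k. \<bar>q k\<bar> < r) sequentially"
    using tendsto_rabs[OF assms(2)] r(1) by (rule order_tendstoD)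
  then obtain N where N: "\<And>k. k \<ge> N \<Longrightarrow> \<bar>q k\<bar> < r"
    by (auto simp: eventually_sequentially)
  show ?thesis
  proof (rule summable_ratio_test[OF r(2), of N])
    show "norm \<bar>f (Suc k)\<bar> \<le> r * norm \<bar>f k\<bar>" if "k \<ge> N" for k
      using N[OF that] by (simp add: assms(1) abs_mult mult_right_mono)
  qed
qed

lemma summable_hyp1F2_abs:
  assumes "0 < a" "0 < b" "0 < c"
  shows "summable (\<lambda>k. \<bar>hyp1F2_coeff a b c k * z ^ k\<bar>)"
proof (rule summable_abs_by_ratio)
  show "hyp1F2_coeff a b c (Suc k) * z ^ Suc k =
      ((a + real k) / ((1 + real k) * (b + real k) * (c + real k)) * z) * (hyp1F2_coeff a b c k * z ^ k)" for k
    by (simp add: hyp1F2_coeff_def pochhammer_Suc mult_ac)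
  show "(\<lambda>k. (a + real k) / ((1 + real k) * (b + real k) * (c + real k)) * z) \<longlonglongrightarrow> 0"
    by (rule tendsto_mult_left_zero) real_asymp
qed simp

lemma summable_hyp1F2:
  assumes "0 < a" "0 < b" "0 < c"
  shows "summable (\<lambda>k. hyp1F2_coeff a b c k * z ^ k)"
  using summable_hyp1F2_abs[OF assms] by (rule summable_rabs_cancel)

lemma isCont_hyp1F2:
  assumes "0 < a" "0 < b" "0 < c"
  shows "isCont (hyp1F2 a b c) z"
  unfolding hyp1F2_eq[abs_def]
  by (rule isCont_powser_converges_everywhere[OF summable_hyp1F2[OF assms]])

lemma hyp1F2_0 [simp]: "hyp1F2 a b c 0 = 1"
  using powser_zero[of "hyp1F2_coeff a b c"] by (simp add: hyp1F2_eq) (simp add: hyp1F2_coeff_def)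

lemma Phi_0 [simp]: "Phi a b c 0 = 1"
  by (simp add: Phi_def)

lemma isCont_Phi:
  assumes "0 < a" "0 < b" "0 < c"
  shows "isCont (Phi a b c) x"
  unfolding Phi_def[abs_def]
  by (rule isCont_o2[OF _ isCont_hyp1F2[OF assms]]) auto

lemma continuous_on_Phi:
  assumes "0 < a" "0 < b" "0 < c"
  shows "continuous_on S (Phi a b c)"
  using isCont_Phi[OF assms] by (blast intro: continuous_at_imp_continuous_on)

section \<open>Beta averages that raise a lower parameter\<close>

lemma Beta_pos: "0 < x \<Longrightarrow> 0 < y \<Longrightarrow> 0 < Beta x (y::real)"
  by (simp add: Beta_def Gamma_real_pos)

lemma Beta_add_nat_left:
  fixes x y :: real
  assumes "0 < x" "0 < y"
  shows "Beta (x + real n) y = Beta x y * pochhammer x n / pochhammer (x + y) n"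
proof -
  have "x \<notin> \<int>\<^sub>\<le>\<^sub>0" "x + y \<notin> \<int>\<^sub>\<le>\<^sub>0"
    using assms by (auto elim!: nonpos_Ints_cases)
  moreover have "Gamma x \<noteq> 0" "Gamma (x + y) \<noteq> 0" "Gamma (x + y + real n) \<noteq> 0"
    using assms by (simp_all add: Gamma_real_pos less_imp_neq[symmetric])
  ultimately show ?thesis
    using assms by (simp add: Beta_def pochhammer_Gamma field_simps add_ac)
qed

lemma has_integral_Beta_moments:
  fixes x y :: real
  assumes "0 < x" "0 < y"
  shows "((\<lambda>t. (t powr (x - 1) * (1 - t) powr (y - 1)) * t ^ n) has_integral
           Beta x y * pochhammer x n / pochhammer (x + y) n) {0..1}"
proof -
  have "((\<lambda>t. t powr (x + real n - 1) * (1 - t) powr (y - 1)) has_integral Beta (x + real n) y) {0..1}"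
    by (rule has_integral_Beta_real) (use assms in auto)
  then show ?thesis
    unfolding Beta_add_nat_left[OF assms]
  proof (rule has_integral_eq[rotated])
    \<comment> \<open>At \<open>t = 0\<close> both sides vanish, even for \<open>n = 0\<close>,
      because \<open>0 powr\<close> any exponent is 0.\<close>
    fix t :: real assume "t \<in> {0..1}"
    then show "t powr (x + real n - 1) * (1 - t) powr (y - 1) = t powr (x - 1) * (1 - t) powr (y - 1) * t ^ n"
      by (cases "t = 0") (auto simp: powr_add powr_diff powr_realpow)
  qed
qed

text \<open>The n-th Beta moment contributes (b)_n / (b')_n: it cancels (b)_n in the coefficient and
  puts (b')_n in its place. This is a fractional integral of Riemann-Liouville type in the variable
  \<open>z\<close>.\<close>

lemma hyp1F2_fractional_integral:
  assumes "0 < a" "0 < b" "0 < c" "b < b'"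
  shows "((\<lambda>t. (t powr (b - 1) * (1 - t) powr (b' - b - 1)) * hyp1F2 a b c (z * t)) has_integral
           Beta b (b' - b) * hyp1F2 a b' c z) {0..1}"
proof -
  define C where "C k = hyp1F2_coeff a b c k * z ^ k" for k
  have b': "0 < b'" "0 < b' - b" using assms by auto
  have eq: "C n * (Beta b (b' - b) * pochhammer b n / pochhammer (b + (b' - b)) n)
      = Beta b (b' - b) * (hyp1F2_coeff a b' c n * z ^ n)" for n
    using assms pochhammer_pos[of b n] by (simp add: C_def hyp1F2_coeff_def mult_ac)
  have eq': "\<bar>C n\<bar> * (Beta b (b' - b) * pochhammer b n / pochhammer (b + (b' - b)) n)
      = Beta b (b' - b) * \<bar>hyp1F2_coeff a b' c n * z ^ n\<bar>" for n
    using arg_cong[OF eq[of n], of abs] assms b' pochhammer_pos[of b n] pochhammer_pos[of b' n]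
      Beta_pos[OF assms(2) b'(2)]
    by (simp add: abs_mult)
  have "((\<lambda>t. (t powr (b - 1) * (1 - t) powr (b' - b - 1)) * (\<Sum>n. C n * t ^ n)) has_integral
       (\<Sum>n. C n * (Beta b (b' - b) * pochhammer b n / pochhammer (b + (b' - b)) n))) {0..1}"
  proof (rule has_integral_powser(2))
    show "((\<lambda>t. (t powr (b - 1) * (1 - t) powr (b' - b - 1)) * t ^ n) has_integral
       Beta b (b' - b) * pochhammer b n / pochhammer (b + (b' - b)) n) {0..1}" for n
      by (rule has_integral_Beta_moments) (use assms in auto)
    show "summable (\<lambda>n. \<bar>C n\<bar> * (Beta b (b' - b) * pochhammer b n / pochhammer (b + (b' - b)) n))"
      unfolding eq' by (intro summable_mult summable_hyp1F2_abs assms b')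
    show "summable (\<lambda>n. \<bar>C n * t ^ n\<bar>)" if "t \<in> {0..1}" for t
      using summable_hyp1F2_abs[OF assms(1-3), of "z * t"]
      by (simp add: C_def power_mult_distrib mult_ac)
  qed auto
  moreover have "(\<Sum>n. C n * t ^ n) = hyp1F2 a b c (z * t)" for t
    by (simp add: C_def hyp1F2_eq power_mult_distrib mult_ac)
  moreover have "(\<Sum>n. C n * (Beta b (b' - b) * pochhammer b n / pochhammer (b + (b' - b)) n))
      = Beta b (b' - b) * hyp1F2 a b' c z"
    unfolding eq hyp1F2_eq by (rule suminf_mult[OF summable_hyp1F2[OF assms(1) b'(1) assms(3)]])
  ultimately show ?thesis by simp
qed

text \<open>The value at \<open>x\<close> is a positive multiple of a weighted integral of the
  values at \<open>x * sqrt t\<close>. The integrand is nonnegative, and strictly positive for small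
  \<open>t > 0\<close> because \<open>Phi\<close> is 1 at the origin; hence the strict conclusion
  from a weak hypothesis.\<close>

lemma Phi_pos_of_nonneg:
  assumes "0 < a" "0 < b" "0 < c" "b < b'"
    and nonneg: "\<And>y. 0 < y \<Longrightarrow> y < x \<Longrightarrow> 0 \<le> Phi a b c y"
    and "0 < x"
  shows "0 < Phi a b' c x"
proof -
  define z where "z = - (x\<^sup>2) / 4"
  define w where "w t = t powr (b - 1) * (1 - t) powr (b' - b - 1)" for t :: real
  define f where "f t = w t * hyp1F2 a b c (z * t)" for t
  have int: "(f has_integral Beta b (b' - b) * hyp1F2 a b' c z) {0..1}"
    unfolding f_def w_def by (rule hyp1F2_fractional_integral[OF assms(1-4)])
  have Phi_sqrt: "hyp1F2 a b c (z * t) = Phi a b c (x * sqrt t)" if "0 \<le> t" for t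
    using that by (simp add: Phi_def z_def power_mult_distrib)
  have f_nonneg: "0 \<le> f t" if "t \<in> {0..1}" for t
  proof (cases "t = 0 \<or> t = 1")
    \<comment> \<open>Since \<open>0 powr\<close> any exponent is 0, the weight vanishes at both
      ends. In particular no sign is required of \<open>Phi a b c\<close> at \<open>x\<close>
      itself.\<close>
    case True
    then show ?thesis by (auto simp: f_def w_def)
  next
    case False
    then have t: "0 < t" "t < 1" using that by auto
    have "x * sqrt t < x * 1"
      using t \<open>0 < x\<close> by (intro mult_strict_left_mono) auto
    then show ?thesis
      using t \<open>0 < x\<close> nonneg[of "x * sqrt t"] by (simp add: f_def w_def Phi_sqrt)
  qed
  have "eventually (\<lambda>t. 1/2 < hyp1F2 a b c (z * t)) (at 0)"
  proof (rule order_tendstoD(1))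
    show "((\<lambda>t. hyp1F2 a b c (z * t)) \<longlongrightarrow> hyp1F2 a b c (z * 0)) (at 0)"
      by (rule isContD, rule isCont_o2[OF _ isCont_hyp1F2[OF assms(1-3)]]) auto
  qed simp
  then obtain d where d: "0 < d" "\<And>t. t \<noteq> 0 \<Longrightarrow> dist t 0 < d \<Longrightarrow> 1/2 < hyp1F2 a b c (z * t)"
    unfolding eventually_at by auto
  \<comment> \<open>On \<open>{e/2..e}\<close> the weight is continuous and positive, away from both
    ends of the unit interval, and the series exceeds 1/2; the minimum of \<open>f\<close> there
    bounds the whole integral from below.\<close>
  define e where "e = min (d/2) (1/2)"
  have e: "0 < e" "e < 1" "e < d" using d(1) by (auto simp: e_def)
  have sub: "{e/2..e} \<subseteq> {0..1}" using e by auto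
  have f_int: "f integrable_on {e/2..e}"
    using int sub by (meson has_integral_integrable integrable_on_subinterval)
  have cont: "continuous_on {e/2..e} f"
    unfolding f_def w_def using e
    by (intro continuous_intros continuous_at_imp_continuous_on ballI isCont_o2[OF _ isCont_hyp1F2[OF assms(1-3)]]) auto
  have f_pos: "0 < f t" if "t \<in> {e/2..e}" for t
    using that e d(2)[of t] by (auto simp: f_def w_def dist_norm intro!: mult_pos_pos)
  obtain t0 where t0: "t0 \<in> {e/2..e}" "\<And>t. t \<in> {e/2..e} \<Longrightarrow> f t0 \<le> f t"
    using continuous_attains_inf[OF _ _ cont] e by auto
  have "0 < f t0 * (e - e/2)"
    using f_pos[OF t0(1)] e by simp
  also have "\<dots> = integral {e/2..e} (\<lambda>_. f t0)"
    using e by simp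
  also have "\<dots> \<le> integral {e/2..e} f"
    by (rule integral_le) (use f_int t0 in auto)
  also have "\<dots> \<le> integral {0..1} f"
    by (rule integral_subset_le) (use sub f_int int f_nonneg in auto)
  also have "\<dots> = Beta b (b' - b) * hyp1F2 a b' c z"
    using int by (rule integral_unique)
  finally show ?thesis
    using Beta_pos[of b "b' - b"] assms by (simp add: zero_less_mult_iff Phi_def z_def)
qed

subsection \<open>Positive zeros of Bessel functions\<close>

text \<open>Equal upper and lower parameters cancel and leave 0F1(; c; -x^2/4). Writing that
  function as \<open>Phi 1 1 c\<close> makes every result on \<open>Phi\<close> available for Bessel
  functions.\<close>

lemma Phi_cancel:
  assumes "0 < a"
  shows "Phi a a c = Phi 1 1 c"
proof -
  have "pochhammer a k \<noteq> 0" for k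
    using assms pochhammer_pos[of a k] by simp
  then have "hyp1F2_coeff a a c = hyp1F2_coeff 1 1 c"
    by (simp add: hyp1F2_coeff_def fun_eq_iff pochhammer_fact[symmetric])
  then show ?thesis
    by (simp add: Phi_def hyp1F2_eq fun_eq_iff)
qed

lemma Phi_half_eq_cos: "Phi 1 1 (1/2) x = cos x"
proof -
  have "(- 1) ^ n / fact (2 * n) * x ^ (2 * n) = hyp1F2_coeff 1 1 (1/2) n * (- x\<^sup>2 / 4) ^ n" for n
  proof -
    have "(- x\<^sup>2 / 4) ^ n = (- 1) ^ n * x ^ (2 * n) / 4 ^ n"
      using power_mult_distrib[of "-1" "x\<^sup>2 / 4" n] by (simp add: power_divide power_mult)
    then show ?thesis
      by (simp add: hyp1F2_coeff_def fact_double power_mult flip: pochhammer_fact)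
  qed
  then have "(\<lambda>n. hyp1F2_coeff 1 1 (1/2) n * (- x\<^sup>2 / 4) ^ n) sums cos x"
    using cos_paired[of x] by simp
  then show ?thesis
    by (simp add: Phi_def hyp1F2_eq sums_iff)
qed

text \<open>Termwise differentiation. In Bessel terms this is the rule that x^(-nu) J_nu has
  derivative -x^(-nu) J_(nu+1), so differentiation raises \<open>c\<close> by one.\<close>

lemma has_field_derivative_Phi_1_1:
  assumes "0 < c"
  shows "(Phi 1 1 c has_field_derivative - (x / (2 * c)) * Phi 1 1 (c + 1) x) (at x)"
proof -
  have "diffs (hyp1F2_coeff 1 1 c) n = hyp1F2_coeff 1 1 (c + 1) n / c" for n
    by (simp add: diffs_def hyp1F2_coeff_def pochhammer_fact[symmetric] pochhammer_rec[of c])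
  then have "(\<Sum>n. diffs (hyp1F2_coeff 1 1 c) n * z ^ n) = hyp1F2 1 1 (c + 1) z / c" for z
    using suminf_divide[OF summable_hyp1F2[of 1 1 "c + 1" z], of c] assms by (simp add: hyp1F2_eq)
  moreover have "((\<lambda>z. \<Sum>n. hyp1F2_coeff 1 1 c n * z ^ n) has_field_derivative
      (\<Sum>n. diffs (hyp1F2_coeff 1 1 c) n * z ^ n)) (at z)" for z
    by (rule termdiffs_strong_converges_everywhere) (use assms summable_hyp1F2 in auto)
  ultimately have "(hyp1F2 1 1 c has_field_derivative hyp1F2 1 1 (c + 1) z / c) (at z)" for z
    by (simp add: hyp1F2_eq[abs_def])
  moreover have "((\<lambda>x. - x\<^sup>2 / 4) has_field_derivative - x / 2) (at x)"
    by (auto intro!: derivative_eq_intros)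
  ultimately have "((\<lambda>x. hyp1F2 1 1 c (- x\<^sup>2 / 4)) has_field_derivative
      hyp1F2 1 1 (c + 1) (- x\<^sup>2 / 4) / c * (- x / 2)) (at x)"
    by (rule DERIV_chain2)
  then show ?thesis
    by (simp add: Phi_def[abs_def] mult_ac)
qed

text \<open>Induction from the cosine. Zeros beyond every bound \<open>X\<close> are claimed because
  Rolle's theorem uses up two zeros of one function to produce one zero of the next.\<close>

lemma Phi_half_integer_zero: "\<exists>x>X. Phi 1 1 (real n + 1/2) x = 0"
proof (induction n arbitrary: X)
  case 0
  obtain m :: nat where "X < real m"
    using reals_Archimedean2 by blast
  moreover have "real m * 1 \<le> real m * pi"
    using pi_gt3 by (intro mult_left_mono) auto
  ultimately have "X < real m * pi + pi / 2"
    using pi_gt_zero by linarith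
  moreover have "cos (real m * pi + pi / 2) = 0"
    by (simp add: cos_add)
  ultimately show ?case
    using Phi_half_eq_cos by auto
next
  case (Suc n)
  define c where "c = real n + 1/2"
  have c: "0 < c" by (simp add: c_def)
  \<comment> \<open>The bound \<open>max X 0\<close> keeps the zeros positive, so that the factor
    \<open>z / (2 * c)\<close> of the derivative can be divided out.\<close>
  obtain x where x: "max X 0 < x" "Phi 1 1 c x = 0"
    using Suc.IH[of "max X 0"] by (auto simp: c_def)
  obtain y where y: "x < y" "Phi 1 1 c y = 0"
    using Suc.IH[of x] by (auto simp: c_def)
  obtain z where z: "x < z" "z < y" "(\<lambda>v. - (z / (2 * c)) * Phi 1 1 (c + 1) z * v) = (\<lambda>v. 0)"
  proof -
    have "\<exists>z>x. z < y \<and> (\<lambda>v. - (z / (2 * c)) * Phi 1 1 (c + 1) z * v) = (\<lambda>v. 0)"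
    proof (rule Rolle_deriv[OF y(1)])
      show "Phi 1 1 c x = Phi 1 1 c y"
        by (simp only: x(2) y(2))
      show "continuous_on {x..y} (Phi 1 1 c)"
        by (rule continuous_on_Phi) (simp_all add: c)
      show "(Phi 1 1 c has_derivative (\<lambda>v. - (z / (2 * c)) * Phi 1 1 (c + 1) z * v)) (at z)" for z
        using has_field_derivative_Phi_1_1[OF c] unfolding has_field_derivative_def .
    qed
    then show ?thesis using that by blast
  qed
  from fun_cong[OF z(3), of 1] have "Phi 1 1 (c + 1) z = 0"
    using x z(1) c by auto
  then show ?case
    using x z(1) by (intro exI[of _ z]) (auto simp: c_def add_ac)
qed

text \<open>If \<open>Phi 1 1 c\<close> were nonnegative, raising \<open>c\<close> to a larger
  half-integer would give a strictly positive function, against the zero found there. Commuting the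
  lower parameters makes \<open>c\<close> the one that is raised.\<close>

lemma Phi_1_1_takes_negative:
  assumes "0 < c"
  shows "\<exists>x>0. Phi 1 1 c x < 0"
proof (rule ccontr)
  assume "\<not> ?thesis"
  then have nonneg: "0 \<le> Phi 1 c 1 x" if "0 < x" for x
    using that by (force simp: Phi_commute[of 1 1 c])
  obtain n :: nat where n: "c < real n"
    using reals_Archimedean2 by blast
  obtain x where x: "0 < x" "Phi 1 1 (real n + 1/2) x = 0"
    using Phi_half_integer_zero[of 0 n] by auto
  have "0 < Phi 1 (real n + 1/2) 1 x"
    by (rule Phi_pos_of_nonneg[of 1 c]) (use assms n x nonneg in auto)
  with x show False
    by (simp add: Phi_commute[of 1 1])
qed

section \<open>From a negative value to a zero, and the first Bessel zero\<close>

lemma Phi_zero_of_negative: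
  assumes "0 < a" "0 < b" "0 < c" and "0 < y" "Phi a b c y < 0"
  shows "\<exists>x. 0 < x \<and> x < y \<and> Phi a b c x = 0"
proof -
  have "\<exists>x. 0 \<le> x \<and> x \<le> y \<and> Phi a b c x = 0"
  proof (rule IVT2')
    show "continuous_on {0..y} (Phi a b c)"
      by (rule continuous_on_Phi[OF assms(1-3)])
  qed (use assms in \<open>simp_all add: less_imp_le\<close>)
  then obtain x where "0 \<le> x" "x \<le> y" "Phi a b c x = 0"
    by blast
  moreover from this have "x \<noteq> 0" "x \<noteq> y"
    using assms by auto
  ultimately have "0 < x \<and> x < y \<and> Phi a b c x = 0"
    by linarith
  then show ?thesis by blast
qed

lemma Phi_takes_positive:
  assumes "0 < a" "0 < b" "0 < c"
  shows "\<exists>x>0. 0 < Phi a b c x"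
proof -
  have "((Phi a b c) \<longlongrightarrow> Phi a b c 0) (at 0)"
    by (rule isContD[OF isCont_Phi[OF assms]])
  then have "eventually (\<lambda>x. 0 < Phi a b c x) (at 0)"
    by (rule order_tendstoD) simp
  then obtain d where "0 < d" "\<And>x. x \<noteq> 0 \<Longrightarrow> dist x 0 < d \<Longrightarrow> 0 < Phi a b c x"
    unfolding eventually_at by auto
  then show ?thesis
    by (intro exI[of _ "d/2"]) (auto simp: dist_norm)
qed

lemma alternates_Phi_of_negative:
  assumes "0 < a" "0 < b" "0 < c" and "0 < y" "Phi a b c y < 0"
  shows "alternates (Phi a b c)"
  using Phi_takes_positive[OF assms(1-3)] assms(4,5) by (auto simp: alternates_def)

text \<open>The prefactor is nonzero for \<open>x > 0\<close>, so J_(c-1) and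
  \<open>Phi 1 1 c\<close> have the same positive zeros.\<close>

lemma BesselJ_eq_Phi:
  assumes "0 < c" "0 < x"
  shows "BesselJ (c - 1) x = (x / 2) powr (c - 1) / Gamma c * Phi 1 1 c x"
proof -
  have c: "c \<notin> \<int>\<^sub>\<le>\<^sub>0" using assms by (auto elim!: nonpos_Ints_cases)
  have "(-1) ^ k / (fact k * Gamma (real k + (c - 1) + 1)) * (x / 2) powr (2 * real k + (c - 1))
      = (x / 2) powr (c - 1) / Gamma c * (hyp1F2_coeff 1 1 c k * (- (x\<^sup>2) / 4) ^ k)" for k
  proof -
    have "Gamma (real k + (c - 1) + 1) = pochhammer c k * Gamma c"
      using c Gamma_real_pos[OF assms(1)] by (simp add: pochhammer_Gamma add_ac)
    moreover have "(x / 2) powr (2 * real k + (c - 1)) = (x\<^sup>2 / 4) ^ k * (x / 2) powr (c - 1)"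
      using assms(2) powr_realpow[of "x / 2" "2 * k"]
      by (simp add: powr_add power_mult power_divide)
    moreover have "(- (x\<^sup>2) / 4) ^ k = (-1) ^ k * (x\<^sup>2 / 4) ^ k"
      using power_mult_distrib[of "-1" "x\<^sup>2 / 4" k] by simp
    ultimately show ?thesis
      by (simp add: hyp1F2_coeff_def pochhammer_fact[symmetric] mult_ac)
  qed
  then have "BesselJ (c - 1) x = (\<Sum>k. (x / 2) powr (c - 1) / Gamma c * (hyp1F2_coeff 1 1 c k * (- (x\<^sup>2) / 4) ^ k))"
    by (simp add: BesselJ_def)
  also have "\<dots> = (x / 2) powr (c - 1) / Gamma c * Phi 1 1 c x"
    unfolding Phi_def hyp1F2_eq
    by (rule suminf_mult) (rule summable_hyp1F2, use assms in auto)
  finally show ?thesis .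
qed

text \<open>\<open>LEAST\<close> over the reals is meaningful only if the minimum is attained, so
  the proof must exhibit a smallest positive zero.\<close>

lemma bessel_zero:
  assumes "0 < c"
  shows "0 < bessel_zero (c - 1)" and "Phi 1 1 c (bessel_zero (c - 1)) = 0"
proof -
  \<comment> \<open>Admitting 0 in the condition makes \<open>Z\<close> closed, so
    \<open>Inf Z\<close> belongs to it; as \<open>Phi\<close> is 1 at the origin,
    \<open>Inf Z\<close> is nevertheless positive.\<close>
  define Z where "Z = {x. 0 \<le> x \<and> Phi 1 1 c x = 0}"
  have "closed Z"
    unfolding Z_def using continuous_on_Phi[of 1 1 c UNIV] assms
    by (intro closed_Collect_conj closed_Collect_le closed_Collect_eq) (auto intro: continuous_intros)
  moreover have "Z \<noteq> {}"
  proof -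
    obtain y where y: "0 < y" "Phi 1 1 c y < 0"
      using Phi_1_1_takes_negative[OF assms] by blast
    obtain x where "0 < x" "Phi 1 1 c x = 0"
      using Phi_zero_of_negative[OF zero_less_one zero_less_one assms y] by blast
    then have "x \<in> Z" by (simp add: Z_def)
    then show ?thesis by blast
  qed
  moreover have bdd: "bdd_below Z"
    by (auto simp: Z_def intro!: bdd_belowI[of _ 0])
  ultimately have "Inf Z \<in> Z"
    by (intro closed_contains_Inf)
  then have "0 \<le> Inf Z" "Phi 1 1 c (Inf Z) = 0" by (auto simp: Z_def)
  moreover from this have "Inf Z \<noteq> 0" by (metis Phi_0 zero_neq_one)
  ultimately have Inf: "0 < Inf Z" "Phi 1 1 c (Inf Z) = 0" by auto
  have iff: "BesselJ (c - 1) x = 0 \<longleftrightarrow> Phi 1 1 c x = 0" if "0 < x" for x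
  proof -
    have "(x / 2) powr (c - 1) / Gamma c \<noteq> 0"
      using that less_imp_neq[OF Gamma_real_pos[OF assms]] by simp
    then show ?thesis
      unfolding BesselJ_eq_Phi[OF assms that] by (simp only: mult_eq_0_iff simp_thms)
  qed
  have "bessel_zero (c - 1) = Inf Z"
    unfolding bessel_zero_def
  proof (rule Least_equality)
    show "0 < Inf Z \<and> BesselJ (c - 1) (Inf Z) = 0"
      using Inf iff[OF Inf(1)] by blast
    show "Inf Z \<le> x" if "0 < x \<and> BesselJ (c - 1) x = 0" for x
      using that iff[of x] bdd by (intro cInf_lower) (auto simp only: Z_def mem_Collect_eq less_imp_le)
  qed
  then show "0 < bessel_zero (c - 1)" and "Phi 1 1 c (bessel_zero (c - 1)) = 0"
    using Inf by auto
qed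

text \<open>For \<open>b = a\<close> the zero is j_(c-1) itself, which accounts for the closed right
  end. For \<open>b < a\<close>, nonnegativity up to j_(c-1) would make \<open>Phi a a c\<close>
  positive at its own zero, so a negative value, and hence a zero, occurs earlier.\<close>

lemma Phi_alternates_le:
  assumes "0 < a" "0 < b" "0 < c" "b \<le> a"
  shows "alternates (Phi a b c) \<and> (\<exists>x. 0 < x \<and> x \<le> bessel_zero (c - 1) \<and> Phi a b c x = 0)"
proof (cases "b = a")
  case True
  then have eq: "Phi a b c = Phi 1 1 c"
    using assms Phi_cancel by blast
  obtain y where "0 < y" "Phi a b c y < 0"
    using Phi_1_1_takes_negative[OF assms(3)] unfolding eq by blast
  then have "alternates (Phi a b c)"
    by (rule alternates_Phi_of_negative[OF assms(1-3)])
  then show ?thesis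
    using bessel_zero[OF assms(3)] unfolding eq by blast
next
  case False
  define j where "j = bessel_zero (c - 1)"
  have j: "0 < j" "Phi a a c j = 0"
    using bessel_zero[OF assms(3)] Phi_cancel[OF assms(1)] by (auto simp: j_def)
  have "\<exists>y. 0 < y \<and> y < j \<and> Phi a b c y < 0"
    using Phi_pos_of_nonneg[of a b c a j] assms False j by force
  then obtain y where y: "0 < y" "y < j" "Phi a b c y < 0" by blast
  then show ?thesis
    using alternates_Phi_of_negative[OF assms(1-3)] Phi_zero_of_negative[OF assms(1-3)]
    unfolding j_def by (meson less_imp_le less_trans)
qed

section \<open>The square of a Bessel function as a 1F2\<close>

lemma sum_binomial_pochhammer:
  fixes g :: real
  shows "(\<Sum>i\<le>k. real (k choose i) * (pochhammer (g + real i) (k - i) * pochhammer (g + real (k - i)) i))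
    = pochhammer (2 * g + real k - 1) k"
proof -
  \<comment> \<open>A falling product of length k - i from this \<open>s\<close> ends at g + i, so
    each summand is k! times a product of two generalized binomial coefficients of \<open>s\<close>,
    and Vandermonde's identity sums them.\<close>
  define s where "s = g + real k - 1"
  have eq: "real (k choose i) * (pochhammer (g + real i) (k - i) * pochhammer (g + real (k - i)) i)
      = fact k * ((s gchoose i) * (s gchoose (k - i)))" if "i \<le> k" for i
  proof -
    have "s gchoose (k - i) = pochhammer (g + real i) (k - i) / fact (k - i)"
      using that by (simp add: gbinomial_pochhammer' s_def of_nat_diff)
    moreover have "s gchoose i = pochhammer (g + real (k - i)) i / fact i"
      using that by (simp add: gbinomial_pochhammer' s_def of_nat_diff algebra_simps)
    ultimately show ?thesis
      using that by (simp add: binomial_fact)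
  qed
  have "(\<Sum>i\<le>k. real (k choose i) * (pochhammer (g + real i) (k - i) * pochhammer (g + real (k - i)) i))
      = fact k * (\<Sum>i\<le>k. (s gchoose i) * (s gchoose (k - i)))"
    unfolding sum_distrib_left by (rule sum.cong) (use eq in auto)
  also have "(\<Sum>i\<le>k. (s gchoose i) * (s gchoose (k - i))) = (s + s) gchoose k"
    using gbinomial_Vandermonde[of s s k] by (simp add: atLeast0AtMost)
  also have "fact k * \<dots> = pochhammer (2 * g + real k - 1) k"
    by (simp add: gbinomial_pochhammer' s_def algebra_simps)
  finally show ?thesis .
qed

text \<open>The Cauchy product of 0F1(; g) with itself, where g = a + 1/2. Its coefficients are
  evaluated by \<open>sum_binomial_pochhammer\<close> and the duplication formula; halving the
  argument on the right absorbs the resulting 4^k.\<close>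

lemma Phi_eq_square:
  assumes "0 < a"
  shows "Phi a (a + 1/2) (2 * a) x = (Phi 1 1 (a + 1/2) (x / 2))\<^sup>2"
proof -
  define g where "g = a + 1/2"
  have g: "0 < g" using assms by (simp add: g_def)
  define h where "h k = hyp1F2_coeff 1 1 g k * (- ((x / 2)\<^sup>2) / 4) ^ k" for k
  have sm: "summable (\<lambda>k. norm (h k))"
    unfolding h_def real_norm_def by (rule summable_hyp1F2_abs) (use g in auto)
  have "(\<Sum>i\<le>k. h i * h (k - i)) = hyp1F2_coeff a g (2 * a) k * (- (x\<^sup>2) / 4) ^ k" for k
  proof -
    have "h i * h (k - i) = (- ((x / 2)\<^sup>2) / 4) ^ k / (fact k * pochhammer g k ^ 2) *
        (real (k choose i) * (pochhammer (g + real i) (k - i) * pochhammer (g + real (k - i)) i))" if "i \<le> k" for i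
    proof -
      have 1: "pochhammer g k = pochhammer g i * pochhammer (g + real i) (k - i)"
        using that by (rule pochhammer_product)
      have 2: "pochhammer g k = pochhammer g (k - i) * pochhammer (g + real (k - i)) i"
        using pochhammer_product'[of g "k - i" i] that by (simp only: le_add_diff_inverse2)
      have nz: "pochhammer g m \<noteq> 0" "pochhammer (g + real n) m \<noteq> 0" for m n
        using pochhammer_pos[of g m] pochhammer_pos[of "g + real n" m] g by auto
      \<comment> \<open>Completing both denominators to \<open>pochhammer g k\<close> moves the
        dependence on \<open>i\<close> into the numerators, as the Vandermonde sum requires.\<close>
      have 3: "1 / pochhammer g i = pochhammer (g + real i) (k - i) / pochhammer g k"
        using nz by (simp add: 1)
      have 4: "1 / pochhammer g (k - i) = pochhammer (g + real (k - i)) i / pochhammer g k"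
        using nz by (simp add: 2)
      have "h i * h (k - i) = (- ((x / 2)\<^sup>2) / 4) ^ k / (fact i * fact (k - i)) *
          (1 / pochhammer g i * (1 / pochhammer g (k - i)))"
        using power_add[of "- ((x / 2)\<^sup>2) / 4" i "k - i"] that
        by (simp add: h_def hyp1F2_coeff_def flip: pochhammer_fact)
      also have "1 / (fact i * fact (k - i) :: real) = real (k choose i) / fact k"
        using that by (simp add: binomial_fact)
      ultimately show ?thesis
        unfolding 3 4 using that by (simp add: binomial_fact power2_eq_square)
    qed
    then have "(\<Sum>i\<le>k. h i * h (k - i)) =
        (- ((x / 2)\<^sup>2) / 4) ^ k / (fact k * pochhammer g k ^ 2) * pochhammer (2 * g + real k - 1) k"
      unfolding sum_binomial_pochhammer[symmetric] sum_distrib_left by (intro sum.cong) auto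
    also have "\<dots> = hyp1F2_coeff a g (2 * a) k * (- (x\<^sup>2) / 4) ^ k"
    proof -
      have nz: "pochhammer (2 * a) k \<noteq> 0" "pochhammer g k \<noteq> 0"
        using pochhammer_pos[of "2 * a" k] pochhammer_pos[of g k] assms g by auto
      \<comment> \<open>As 2g = 2a + 1, the sum is (2a + k)_k = (2a)_(2k) / (2a)_k; the duplication
        formula then splits (2a)_(2k).\<close>
      have "pochhammer (2 * a) k * pochhammer (2 * g + real k - 1) k = pochhammer (2 * a) (2 * k)"
        using pochhammer_product'[of "2 * a" k k]
        by (simp only: g_def mult_2[of k]) (simp add: algebra_simps)
      also have "\<dots> = 4 ^ k * pochhammer a k * pochhammer g k"
        using pochhammer_double[of a k] by (simp add: g_def power_mult)
      finally have "pochhammer (2 * g + real k - 1) k = 4 ^ k * pochhammer a k * pochhammer g k / pochhammer (2 * a) k"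
        using nz by (simp add: field_simps)
      moreover have "(- (x\<^sup>2) / 4) ^ k = 4 ^ k * (- ((x / 2)\<^sup>2) / 4) ^ k"
        using power_mult_distrib[of 4 "- ((x / 2)\<^sup>2) / 4" k] by (simp add: power_divide)
      ultimately show ?thesis
        using nz by (simp add: hyp1F2_coeff_def power2_eq_square mult_ac)
    qed
    finally show ?thesis .
  qed
  then have "(\<Sum>k. hyp1F2_coeff a g (2 * a) k * (- (x\<^sup>2) / 4) ^ k) = (\<Sum>k. h k) * (\<Sum>k. h k)"
    using Cauchy_product_sums[OF sm sm] by (simp add: sums_iff)
  then show ?thesis
    by (simp add: Phi_def hyp1F2_eq g_def h_def power2_eq_square)
qed

text \<open>At \<open>j\<close> the comparison square vanishes. The parameters are raised one at a
  time to a + 1/2 and 2a; the strict bound on \<open>b + c\<close> ensures that at least one of them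
  really increases, which gives strict positivity at \<open>j\<close> and the contradiction.\<close>

lemma Phi_alternates_below_square:
  assumes "0 < a" "0 < b" "0 < c" "b \<le> a + 1/2" "c \<le> 2 * a" "b + c < 3 * a + 1/2"
  shows "alternates (Phi a b c) \<and> (\<exists>x. 0 < x \<and> x < 2 * bessel_zero (a - 1/2) \<and> Phi a b c x = 0)"
proof -
  define j where "j = 2 * bessel_zero (a - 1/2)"
  have "bessel_zero (a - 1/2) = bessel_zero (a + 1/2 - 1)" by simp
  then have j: "0 < j" "Phi a (a + 1/2) (2 * a) j = 0"
    using bessel_zero[of "a + 1/2"] assms(1) by (simp_all add: j_def Phi_eq_square)
  have "\<exists>y. 0 < y \<and> y < j \<and> Phi a b c y < 0"
  proof (rule ccontr)
    assume "\<not> ?thesis"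
    then have nonneg: "0 \<le> Phi a b c y" if "0 < y" "y < j" for y
      using that by force
    have pos: "0 < Phi a (a + 1/2) c y" if "b < a + 1/2" "0 < y" "y \<le> j" for y
      by (rule Phi_pos_of_nonneg[of a b]) (use assms that nonneg in auto)
    have nonneg': "0 \<le> Phi a c (a + 1/2) y" if "0 < y" "y < j" for y
      using nonneg[OF that] pos[of y] that assms(4)
      by (cases "b = a + 1/2") (auto simp: Phi_commute[of a c])
    show False
    proof (cases "c = 2 * a")
      case True
      then show False using pos[of j] assms j by auto
    next
      case False
      then have "0 < Phi a (2 * a) (a + 1/2) j"
        by (intro Phi_pos_of_nonneg[of a c]) (use assms j nonneg' in auto)
      then show False
        using j by (simp add: Phi_commute[of a "2 * a"])
    qed
  qed
  then obtain y where y: "0 < y" "y < j" "Phi a b c y < 0" by blast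
  then show ?thesis
    using alternates_Phi_of_negative[OF assms(1-3)] Phi_zero_of_negative[OF assms(1-3)]
    unfolding j_def by (meson less_trans)
qed

subsection \<open>Gaussian and Laplace averages\<close>

text \<open>Substitution in Euler's integral for Gamma. It is applied to the maps x to p x and x to
  t x^2, which are bijections of the open half-line.\<close>

lemma has_integral_Gamma_substitution:
  fixes g g' :: "real \<Rightarrow> real"
  assumes s: "0 < s"
    and deriv: "\<And>x. 0 < x \<Longrightarrow> (g has_field_derivative g' x) (at x)"
    and g': "\<And>x. 0 < x \<Longrightarrow> 0 \<le> g' x"
    and bij: "bij_betw g {0<..} {0<..}"
  shows "((\<lambda>x. g' x * (g x powr (s - 1) / exp (g x))) has_integral Gamma s) {0<..}"
proof -
  define f where "f y = y powr (s - 1) / exp y" for y :: real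
  have "(f has_integral Gamma s) {0<..}"
  proof -
    have "(f has_integral Gamma s) {0..}"
      unfolding f_def by (rule Gamma_integral_real[OF s])
    then show ?thesis
      by (rule has_integral_spike_set_eq[THEN iffD1, rotated -1])
         (auto intro: negligible_subset[of "{0}"])
  qed
  then have "f absolutely_integrable_on {0<..} \<and> integral {0<..} f = Gamma s"
    by (auto intro!: nonnegative_absolutely_integrable_1 simp: f_def has_integral_iff)
  then have "f absolutely_integrable_on (g ` {0<..}) \<and> integral (g ` {0<..}) f = Gamma s"
    using bij by (simp add: bij_betw_def)
  then have "(\<lambda>x. \<bar>g' x\<bar> * f (g x)) absolutely_integrable_on {0<..} \<and>
      integral {0<..} (\<lambda>x. \<bar>g' x\<bar> * f (g x)) = Gamma s"
    by (subst has_absolute_integral_change_of_variables_1')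
       (use bij deriv in \<open>auto simp: bij_betw_def intro: DERIV_subset\<close>)
  then have "((\<lambda>x. \<bar>g' x\<bar> * f (g x)) has_integral Gamma s) {0<..}"
    by (auto simp: has_integral_iff absolutely_integrable_on_def)
  then show ?thesis
    by (rule has_integral_eq[rotated]) (use g' in \<open>simp add: f_def\<close>)
qed

lemma has_integral_Gamma_scaled:
  fixes p s :: real
  assumes "0 < s" "0 < p"
  shows "((\<lambda>x. x powr (s - 1) * exp (- (p * x))) has_integral Gamma s / p powr s) {0<..}"
proof -
  have "bij_betw (\<lambda>x. p * x) {0<..} {0<..}"
    by (rule bij_betwI[where g = "\<lambda>x. x / p"]) (use assms in auto)
  then have "((\<lambda>x. p * ((p * x) powr (s - 1) / exp (p * x))) has_integral Gamma s) {0<..}"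
    by (intro has_integral_Gamma_substitution)
       (use assms in \<open>auto intro!: derivative_eq_intros\<close>)
  from has_integral_mult_right[OF this, of "1 / p powr s"]
  have "((\<lambda>x. 1 / p powr s * (p * ((p * x) powr (s - 1) / exp (p * x)))) has_integral Gamma s / p powr s) {0<..}"
    by simp
  then show ?thesis
    by (rule has_integral_eq[rotated])
       (use assms in \<open>simp add: powr_mult powr_diff exp_minus field_simps\<close>)
qed

lemma has_integral_Gaussian_moment:
  fixes s t :: real
  assumes "0 < s" "0 < t"
  shows "((\<lambda>x. x powr (2 * s - 1) * exp (- (t * x\<^sup>2))) has_integral Gamma s / (2 * t powr s)) {0<..}"
proof -
  have "bij_betw (\<lambda>x. t * x\<^sup>2) {0<..} {0<..}"
    by (rule bij_betwI[where g = "\<lambda>x. sqrt (x / t)"]) (use assms in \<open>auto simp: real_sqrt_mult\<close>)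
  then have "((\<lambda>x. t * (2 * x) * ((t * x\<^sup>2) powr (s - 1) / exp (t * x\<^sup>2))) has_integral Gamma s) {0<..}"
    by (intro has_integral_Gamma_substitution)
       (use assms in \<open>auto intro!: derivative_eq_intros\<close>)
  from has_integral_mult_right[OF this, of "1 / (2 * t powr s)"]
  have "((\<lambda>x. 1 / (2 * t powr s) * (t * (2 * x) * ((t * x\<^sup>2) powr (s - 1) / exp (t * x\<^sup>2))))
      has_integral Gamma s / (2 * t powr s)) {0<..}"
    by simp
  then show ?thesis
  proof (rule has_integral_eq[rotated])
    fix x :: real assume "x \<in> {0<..}"
    then have x: "0 < x" by simp
    have "(x\<^sup>2) powr (s - 1) = x powr (2 * s - 2)"
      using x by (simp add: powr_powr algebra_simps flip: powr_numeral)
    then have "(t * x\<^sup>2) powr (s - 1) = t powr s / t * (x powr (2 * s - 1) / x)"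
      using x assms by (simp add: powr_mult powr_diff powr_numeral power2_eq_square)
    then show "1 / (2 * t powr s) * (t * (2 * x) * ((t * x\<^sup>2) powr (s - 1) / exp (t * x\<^sup>2)))
        = x powr (2 * s - 1) * exp (- (t * x\<^sup>2))"
      using x assms by (simp add: exp_minus field_simps)
  qed
qed

text \<open>This is ln u <= u - 1 at u = v / s; the further factor exp(-s) that it yields is
  dropped.\<close>

lemma powr_mult_exp_le:
  fixes v s :: real
  assumes "0 < v" "0 < s"
  shows "v powr s * exp (- v) \<le> s powr s"
proof -
  have "ln (v / s) \<le> v / s - 1"
    using assms by (intro ln_le_minus_one) auto
  then have "ln v - ln s \<le> v / s - 1"
    using assms by (simp add: ln_div)
  then have "s * (ln v - ln s) \<le> s * (v / s - 1)"
    using assms by (intro mult_left_mono) auto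
  then have "s * ln v - v \<le> s * ln s"
    using assms by (simp add: algebra_simps)
  then have "exp (s * ln v + - v) \<le> exp (s * ln s)"
    by simp
  then show ?thesis
    unfolding exp_add using assms by (simp add: powr_def)
qed

text \<open>Euler's integral for Kummer's function 1F1(a; c; -y): the exponential is expanded and
  integrated against the Beta moments.\<close>

lemma hyp1F1_integral:
  fixes a c y :: real
  assumes "0 < a" "a < c"
  shows "((\<lambda>t. (t powr (a - 1) * (1 - t) powr (c - a - 1)) * exp (- (y * t))) has_integral
     Beta a (c - a) * (\<Sum>n. pochhammer a n / (fact n * pochhammer c n) * (- y) ^ n)) {0..1}"
    and "summable (\<lambda>n. \<bar>pochhammer a n / (fact n * pochhammer c n) * y ^ n\<bar>)"
proof -
  have c: "0 < c" "0 < c - a" using assms by auto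
  define d where "d n y = pochhammer a n / (fact n * pochhammer c n) * y ^ n" for n and y :: real
  have sm: "summable (\<lambda>n. \<bar>d n y\<bar>)" for y
  proof (rule summable_abs_by_ratio)
    show "d (Suc n) y = ((a + real n) / ((1 + real n) * (c + real n)) * y) * d n y" for n
      by (simp add: d_def pochhammer_Suc mult_ac)
    show "(\<lambda>n. (a + real n) / ((1 + real n) * (c + real n)) * y) \<longlonglongrightarrow> 0"
      by (rule tendsto_mult_left_zero) real_asymp
  qed simp
  then show "summable (\<lambda>n. \<bar>pochhammer a n / (fact n * pochhammer c n) * y ^ n\<bar>)"
    by (simp add: d_def)
  define C where "C n = (- y) ^ n / fact n" for n
  have eq: "C n * (Beta a (c - a) * pochhammer a n / pochhammer (a + (c - a)) n) = Beta a (c - a) * d n (- y)" for n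
    by (simp add: C_def d_def mult_ac)
  have eq': "\<bar>C n\<bar> * (Beta a (c - a) * pochhammer a n / pochhammer (a + (c - a)) n) = Beta a (c - a) * \<bar>d n (- y)\<bar>" for n
    using arg_cong[OF eq[of n], of abs] assms c pochhammer_pos[of a n] pochhammer_pos[of c n]
      Beta_pos[OF assms(1) c(2)]
    by (simp add: abs_mult)
  have "((\<lambda>t. (t powr (a - 1) * (1 - t) powr (c - a - 1)) * (\<Sum>n. C n * t ^ n)) has_integral
       (\<Sum>n. C n * (Beta a (c - a) * pochhammer a n / pochhammer (a + (c - a)) n))) {0..1}"
  proof (rule has_integral_powser(2))
    show "((\<lambda>t. (t powr (a - 1) * (1 - t) powr (c - a - 1)) * t ^ n) has_integral
       Beta a (c - a) * pochhammer a n / pochhammer (a + (c - a)) n) {0..1}" for n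
      by (rule has_integral_Beta_moments) (use assms in auto)
    show "summable (\<lambda>n. \<bar>C n\<bar> * (Beta a (c - a) * pochhammer a n / pochhammer (a + (c - a)) n))"
      unfolding eq' by (intro summable_mult sm)
    show "summable (\<lambda>n. \<bar>C n * t ^ n\<bar>)" if "t \<in> {0..1}" for t
      using summable_norm_exp[of "y * t"]
      by (simp add: C_def abs_mult power_mult_distrib divide_inverse mult_ac power_abs)
  qed auto
  moreover have "(\<Sum>n. C n * t ^ n) = exp (- (y * t))" for t
  proof -
    have "C n * t ^ n = (- (y * t)) ^ n /\<^sub>R fact n" for n
      using power_mult_distrib[of "- y" t n] by (simp add: C_def divide_inverse mult_ac)
    then show ?thesis by (simp add: exp_def)
  qed
  moreover have "(\<Sum>n. C n * (Beta a (c - a) * pochhammer a n / pochhammer (a + (c - a)) n))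
      = Beta a (c - a) * (\<Sum>n. d n (- y))"
    unfolding eq by (rule suminf_mult[OF summable_rabs_cancel[OF sm]])
  ultimately show "((\<lambda>t. (t powr (a - 1) * (1 - t) powr (c - a - 1)) * exp (- (y * t))) has_integral
     Beta a (c - a) * (\<Sum>n. pochhammer a n / (fact n * pochhammer c n) * (- y) ^ n)) {0..1}"
    by (simp add: d_def)
qed

text \<open>In Euler's integral the part near 0 behaves like a Gamma integral of size y^(-a), and on
  the right half the exponential alone is O(y^(-a)).\<close>

lemma hyp1F1_decay:
  fixes a c :: real
  assumes "0 < a" "a < c"
  shows "\<exists>C. \<forall>y>0. (\<Sum>n. pochhammer a n / (fact n * pochhammer c n) * (- y) ^ n) \<le> C * y powr (- a)"
proof -
  define w where "w t = t powr (a - 1) * (1 - t) powr (c - a - 1)" for t :: real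
  define B where "B = Beta a (c - a)"
  have B: "0 < B" using assms by (simp add: B_def Beta_pos)
  \<comment> \<open>For t <= 1/2 the base 1 - t lies in [1/2, 1], so its power is at most 1 or at
    most its value at 1/2, according to the sign of the exponent.\<close>
  define M where "M = max 1 ((1/2) powr (c - a - 1))"
  \<comment> \<open>For t > 1/2, \<open>powr_mult_exp_le\<close> at v = y t, with y t >= y / 2,
    bounds exp(-y t) by K y^(-a).\<close>
  define K where "K = 2 powr a * a powr a"
  \<comment> \<open>Both bounds are nonnegative, so their sum dominates on the whole interval and
    the integral need not be split.\<close>
  have bound: "w t * exp (- (y * t)) \<le> M * (t powr (a - 1) * exp (- (y * t))) + K * y powr (- a) * w t"
    if t: "t \<in> {0..1}" and y: "0 < y" for t y
  proof (cases "t \<le> 1/2")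
    case True
    have "(1 - t) powr (c - a - 1) \<le> M"
    proof (cases "0 \<le> c - a - 1")
      case True
      then have "(1 - t) powr (c - a - 1) \<le> 1 powr (c - a - 1)"
        using t by (intro powr_mono2) auto
      then show ?thesis by (simp add: M_def)
    next
      case False
      then have "(1 - t) powr (c - a - 1) \<le> (1/2) powr (c - a - 1)"
        using \<open>t \<le> 1/2\<close> by (intro powr_mono2') auto
      then show ?thesis by (simp add: M_def)
    qed
    then have "t powr (a - 1) * exp (- (y * t)) * (1 - t) powr (c - a - 1) \<le> t powr (a - 1) * exp (- (y * t)) * M"
      by (intro mult_left_mono) auto
    moreover have "0 \<le> K * y powr (- a) * w t"
      by (simp add: K_def w_def)
    ultimately show ?thesis
      unfolding w_def by (simp only: mult_ac)
  next
    case False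
    have "(y * t) powr a * exp (- (y * t)) \<le> a powr a"
      using False y assms by (intro powr_mult_exp_le) auto
    moreover have "(y / 2) powr a \<le> (y * t) powr a"
      using False y assms by (intro powr_mono2) auto
    ultimately have "(y / 2) powr a * exp (- (y * t)) \<le> a powr a"
      by (meson exp_ge_zero mult_right_mono order_trans)
    then have "exp (- (y * t)) \<le> K * y powr (- a)"
      using y by (simp add: K_def powr_divide powr_minus field_simps)
    then have "w t * exp (- (y * t)) \<le> w t * (K * y powr (- a))"
      by (intro mult_left_mono) (auto simp: w_def)
    moreover have "0 \<le> M * (t powr (a - 1) * exp (- (y * t)))"
      by (simp add: M_def)
    ultimately show ?thesis
      by (simp only: mult_ac)
  qed
  have "B * (\<Sum>n. pochhammer a n / (fact n * pochhammer c n) * (- y) ^ n) \<le> (M * Gamma a + K * B) * y powr (- a)"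
    if y: "0 < y" for y
  proof -
    have 1: "((\<lambda>t. w t * exp (- (y * t))) has_integral
        B * (\<Sum>n. pochhammer a n / (fact n * pochhammer c n) * (- y) ^ n)) {0..1}"
      unfolding w_def B_def by (rule hyp1F1_integral[OF assms])
    define h where "h t = t powr (a - 1) * exp (- (y * t))" for t
    have h0: "(h has_integral Gamma a * y powr (- a)) {0..}"
      using has_integral_Gamma_scaled[OF assms(1) y]
      unfolding h_def powr_minus divide_inverse
      by (rule has_integral_spike_set_eq[THEN iffD1, rotated -1])
         (auto intro: negligible_subset[of "{0}"])
    then have h_abs: "h absolutely_integrable_on {0..}"
      by (auto intro!: nonnegative_absolutely_integrable_1 simp: h_def)
    have h1: "h integrable_on {0..1}"
      using set_integrable_subset[OF h_abs, of "{0..1}"] by (simp add: absolutely_integrable_on_def)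
    have h2: "integral {0..1} h \<le> Gamma a * y powr (- a)"
      using integral_subset_le[OF _ h1, of "{0..}"] h0 by (auto simp: has_integral_iff h_def)
    have w: "(w has_integral B) {0..1}"
      unfolding w_def B_def by (rule has_integral_Beta_real) (use assms in auto)
    have 2: "((\<lambda>t. M * h t + K * y powr (- a) * w t) has_integral
        M * integral {0..1} h + K * y powr (- a) * B) {0..1}"
      by (intro has_integral_add has_integral_mult_right integrable_integral h1 w)
    have "B * (\<Sum>n. pochhammer a n / (fact n * pochhammer c n) * (- y) ^ n)
        \<le> M * integral {0..1} h + K * y powr (- a) * B"
      by (rule has_integral_le[OF 1 2]) (use bound y in \<open>auto simp: h_def\<close>)
    also have "\<dots> \<le> M * (Gamma a * y powr (- a)) + K * y powr (- a) * B"
      using h2 by (intro add_mono mult_left_mono) (auto simp: M_def K_def)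
    finally show ?thesis by (simp add: algebra_simps)
  qed
  then have "(\<Sum>n. pochhammer a n / (fact n * pochhammer c n) * (- y) ^ n) \<le> (M * Gamma a + K * B) / B * y powr (- a)"
    if "0 < y" for y
    using that B by (simp add: field_simps)
  then show ?thesis by blast
qed

text \<open>The Gaussian moments bring in Gamma(b + n), which cancels (b)_n and leaves t^(-b) times
  1F1(a; c; -1/(4t)), up to a constant; the decay of 1F1 supplies the factor t^a.\<close>

lemma Phi_Gaussian_bound:
  assumes "0 < a" "0 < b" "a < c"
  shows "\<exists>C. \<forall>t>0. (\<lambda>x. exp (- (t * x\<^sup>2)) * (x powr (2 * b - 1) * Phi a b c x)) integrable_on {0<..} \<and>
     integral {0<..} (\<lambda>x. exp (- (t * x\<^sup>2)) * (x powr (2 * b - 1) * Phi a b c x)) \<le> C * t powr (a - b)"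
proof -
  have c: "0 < c" using assms by auto
  obtain C where C: "\<And>y. 0 < y \<Longrightarrow> (\<Sum>n. pochhammer a n / (fact n * pochhammer c n) * (- y) ^ n) \<le> C * y powr (- a)"
    using hyp1F1_decay[OF assms(1,3)] by blast
  have "((\<lambda>x. exp (- (t * x\<^sup>2)) * (x powr (2 * b - 1) * Phi a b c x)) has_integral
      Gamma b / (2 * t powr b) * (\<Sum>n. pochhammer a n / (fact n * pochhammer c n) * (- (1 / (4 * t))) ^ n)) {0<..}"
    if t: "0 < t" for t
  proof -
    define K where "K n = hyp1F2_coeff a b c n * (- 1/4) ^ n" for n
    define I where "I n = Gamma (b + real n) / (2 * t powr (b + real n))" for n
    define d where "d n = pochhammer a n / (fact n * pochhammer c n) * (- (1 / (4 * t))) ^ n" for n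
    have b: "b \<notin> \<int>\<^sub>\<le>\<^sub>0" using assms by (auto elim!: nonpos_Ints_cases)
    have Gb: "Gamma b \<noteq> 0" using Gamma_real_pos[OF assms(2)] by simp
    have I: "I n = Gamma b / (2 * t powr b) * (pochhammer b n / t ^ n)" for n
      using t Gb by (simp add: I_def pochhammer_Gamma[OF b] powr_add powr_realpow)
    have KI: "K n * I n = Gamma b / (2 * t powr b) * d n" for n
    proof -
      have "pochhammer b n \<noteq> 0" using pochhammer_pos[OF assms(2), of n] by simp
      moreover have "(- (1 / (4 * t))) ^ n = (- 1/4) ^ n / t ^ n"
        using power_divide[of "- 1/4" t n] by simp
      ultimately show ?thesis
        by (simp add: K_def I d_def hyp1F2_coeff_def mult_ac)
    qed
    have "0 \<le> I n" for n
      using assms by (simp add: I_def Gamma_real_nonneg)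
    then have KI': "\<bar>K n\<bar> * I n = \<bar>Gamma b / (2 * t powr b)\<bar> * \<bar>d n\<bar>" for n
      using arg_cong[OF KI[of n], of abs] by (simp add: abs_mult)
    have sm: "summable (\<lambda>n. \<bar>d n\<bar>)"
      unfolding d_def by (rule hyp1F1_integral(2)[OF assms(1,3)])
    have "((\<lambda>x. (x powr (2 * b - 1) * exp (- (t * x\<^sup>2))) * (\<Sum>n. K n * (x\<^sup>2) ^ n)) has_integral (\<Sum>n. K n * I n)) {0<..}"
    proof (rule has_integral_powser(2))
      show "((\<lambda>x. x powr (2 * b - 1) * exp (- (t * x\<^sup>2)) * (x\<^sup>2) ^ n) has_integral I n) {0<..}" for n
        unfolding I_def
      proof (rule has_integral_eq[rotated, OF has_integral_Gaussian_moment])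
        fix x :: real assume "x \<in> {0<..}"
        then have "x powr (2 * (b + real n) - 1) = x powr (2 * b - 1) * (x\<^sup>2) ^ n"
          using powr_realpow[of x "2 * n"] powr_add[of x "2 * b - 1" "real (2 * n)"]
          by (simp add: algebra_simps power_even_eq power_mult[symmetric])
        then show "x powr (2 * (b + real n) - 1) * exp (- (t * x\<^sup>2)) = x powr (2 * b - 1) * exp (- (t * x\<^sup>2)) * (x\<^sup>2) ^ n"
          by simp
      qed (use assms t in auto)
      show "summable (\<lambda>n. \<bar>K n\<bar> * I n)"
        unfolding KI' by (intro summable_mult sm)
      show "summable (\<lambda>n. \<bar>K n * (x\<^sup>2) ^ n\<bar>)" for x :: real
        using summable_hyp1F2_abs[OF assms(1,2) c, of "(- 1/4) * x\<^sup>2"]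
        by (simp only: power_mult_distrib K_def mult.assoc)
    qed auto
    moreover have "(\<Sum>n. K n * (x\<^sup>2) ^ n) = Phi a b c x" for x
      using power_mult_distrib[of "- 1/4" "x\<^sup>2"] by (simp add: Phi_def hyp1F2_eq K_def mult.assoc)
    moreover have "(\<Sum>n. K n * I n) = Gamma b / (2 * t powr b) * (\<Sum>n. d n)"
      unfolding KI by (rule suminf_mult[OF summable_rabs_cancel[OF sm]])
    ultimately show ?thesis
      by (simp add: d_def mult_ac)
  qed
  moreover have "Gamma b / (2 * t powr b) * (\<Sum>n. pochhammer a n / (fact n * pochhammer c n) * (- (1 / (4 * t))) ^ n)
      \<le> Gamma b / 2 * C * 4 powr a * t powr (a - b)" if t: "0 < t" for t
  proof -
    have "Gamma b / (2 * t powr b) * (\<Sum>n. pochhammer a n / (fact n * pochhammer c n) * (- (1 / (4 * t))) ^ n)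
        \<le> Gamma b / (2 * t powr b) * (C * (1 / (4 * t)) powr (- a))"
      using C[of "1 / (4 * t)"] t assms by (intro mult_left_mono) (auto simp: Gamma_real_nonneg)
    also have "(1 / (4 * t)) powr (- a) = 4 powr a * t powr a"
      using t by (simp add: powr_minus powr_divide powr_mult)
    finally show ?thesis
      using t by (simp add: powr_diff mult_ac)
  qed
  ultimately show ?thesis
    by (intro exI[of _ "Gamma b / 2 * C * 4 powr a"]) (auto simp: has_integral_iff)
qed

lemma summable_powr_mult_exp:
  fixes s :: real
  assumes "0 < s"
  shows "summable (\<lambda>n. exp (1 - real n) * (real n + 1) powr s)"
proof (rule summable_comparison_test'[where N = 0])
  show "summable (\<lambda>n. exp (3/2) * (2 * s) powr s * exp (- 1/2) ^ n)"
    by (intro summable_mult summable_geometric) simp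
  show "norm (exp (1 - real n) * (real n + 1) powr s) \<le> exp (3/2) * (2 * s) powr s * exp (- 1/2) ^ n" for n
  proof -
    \<comment> \<open>With this \<open>v\<close>, the factor exp(-v) absorbs the power of n + 1, and
      the rest of the exponential is the geometric majorant with ratio exp(-1/2).\<close>
    define v where "v = (real n + 1) / 2"
    have v: "0 < v" by (simp add: v_def)
    have "v powr s * exp (- v) \<le> s powr s"
      using v assms by (rule powr_mult_exp_le)
    then have "2 powr s * (v powr s * exp (- v)) \<le> 2 powr s * s powr s"
      by (intro mult_left_mono) auto
    then have "(real n + 1) powr s * exp (- v) \<le> (2 * s) powr s"
      using v assms by (simp add: v_def powr_divide powr_mult)
    then have "exp (3/2) * exp (- 1/2) ^ n * ((real n + 1) powr s * exp (- v)) \<le> exp (3/2) * exp (- 1/2) ^ n * (2 * s) powr s"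
      by (intro mult_left_mono) auto
    moreover have "exp (1 - real n) = exp (3/2) * exp (- 1/2) ^ n * exp (- v)"
      by (simp add: v_def exp_of_nat_mult[symmetric] exp_add[symmetric] field_simps)
    then have "exp (1 - real n) * (real n + 1) powr s = exp (3/2) * exp (- 1/2) ^ n * ((real n + 1) powr s * exp (- v))"
      by (simp only: mult_ac)
    ultimately have "exp (1 - real n) * (real n + 1) powr s \<le> exp (3/2) * (2 * s) powr s * exp (- 1/2) ^ n"
      by (simp only: mult_ac)
    then show ?thesis
      by simp
  qed
qed

text \<open>For n the integer part of v, exp(-v) <= exp(-n), and v <= n + 1 keeps the Gaussian
  factor above exp(-1); the 1 in the exponent of the weight compensates for that loss.\<close>

lemma exp_le_Gaussian_term:
  fixes v :: real
  assumes "0 \<le> v"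
  shows "\<exists>n. exp (- v) \<le> exp (1 - real n) * exp (- ((1 / (real n + 1))\<^sup>2 * v\<^sup>2))"
proof -
  define n where "n = nat \<lfloor>v\<rfloor>"
  have n: "real n \<le> v" "v \<le> real n + 1"
    using assms unfolding n_def by linarith+
  have "v / (real n + 1) \<le> 1" using n by simp
  then have "(v / (real n + 1))\<^sup>2 \<le> 1"
    using assms by (intro power_le_one) auto
  then have "- v \<le> (1 - real n) + (- ((1 / (real n + 1))\<^sup>2 * v\<^sup>2))"
    using n(1) power_mult_distrib[of "1 / (real n + 1)" v 2] by simp
  then show ?thesis
    by (metis exp_add exp_le_cancel_iff)
qed

text \<open>The exponential is dominated by a series of Gaussians with weights exp(1 - n), since at
  each point one term already suffices and all terms are nonnegative. Integrating termwise gives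
  \<sigma>^(-2s) times a convergent series.\<close>

lemma Laplace_bound_of_Gaussian_bound:
  fixes g :: "real \<Rightarrow> real"
  assumes s: "0 < s" and cont: "continuous_on {0<..} g" and nonneg: "\<And>x. 0 < x \<Longrightarrow> 0 \<le> g x"
    and int: "\<And>t. 0 < t \<Longrightarrow> (\<lambda>x. exp (- (t * x\<^sup>2)) * g x) integrable_on {0<..}"
    and bound: "\<And>t. 0 < t \<Longrightarrow> integral {0<..} (\<lambda>x. exp (- (t * x\<^sup>2)) * g x) \<le> C * t powr (- s)"
  shows "\<exists>K. \<forall>\<sigma>>0. (\<lambda>x. exp (- (\<sigma> * x)) * g x) absolutely_integrable_on {0<..} \<and>
     integral {0<..} (\<lambda>x. exp (- (\<sigma> * x)) * g x) \<le> K * \<sigma> powr (- (2 * s))"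
proof -
  define k where "k n = exp (1 - real n) * (real n + 1) powr (2 * s)" for n
  have k: "summable k"
    unfolding k_def by (rule summable_powr_mult_exp) (use s in auto)
  have "(\<lambda>x. exp (- (\<sigma> * x)) * g x) absolutely_integrable_on {0<..} \<and>
     integral {0<..} (\<lambda>x. exp (- (\<sigma> * x)) * g x) \<le> (C * suminf k) * \<sigma> powr (- (2 * s))" if \<sigma>: "0 < \<sigma>" for \<sigma>
  proof -
    \<comment> \<open>These widths come from \<open>exp_le_Gaussian_term\<close> at v = \<sigma>
      x.\<close>
    define t where "t n = (\<sigma> / (real n + 1))\<^sup>2" for n
    have t: "0 < t n" for n using \<sigma> by (simp add: t_def add_pos_nonneg)
    define f where "f n x = exp (1 - real n) * (exp (- (t n * x\<^sup>2)) * g x)" for n x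
    have f_nonneg: "0 \<le> f n x" if "x \<in> {0<..}" for n x
      using nonneg that by (simp add: f_def)
    have f_int: "f n integrable_on {0<..}" for n
      unfolding f_def using integrable_on_cmult_left[OF int[OF t], of "exp (1 - real n)"] by simp
    have f_abs: "f n absolutely_integrable_on {0<..}" for n
      using f_int f_nonneg by (rule nonnegative_absolutely_integrable_1)
    have f_le: "integral {0<..} (f n) \<le> C * \<sigma> powr (- (2 * s)) * k n" for n
    proof -
      have "integral {0<..} (f n) = exp (1 - real n) * integral {0<..} (\<lambda>x. exp (- (t n * x\<^sup>2)) * g x)"
        unfolding f_def by (rule integral_mult_right)
      also have "\<dots> \<le> exp (1 - real n) * (C * t n powr (- s))"
        by (intro mult_left_mono bound t) auto
      also have "t n powr (- s) = \<sigma> powr (- (2 * s)) * (real n + 1) powr (2 * s)"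
      proof -
        have "t n powr (- s) = (\<sigma> / (real n + 1)) powr (- (2 * s))"
          using \<sigma> by (simp add: t_def powr_powr flip: powr_numeral)
        then show ?thesis
          using \<sigma> by (simp add: powr_divide powr_minus field_simps)
      qed
      finally show ?thesis by (simp add: k_def mult_ac)
    qed
    have f_ge: "0 \<le> integral {0<..} (f n)" for n
      by (intro integral_nonneg f_int f_nonneg)
    have sm_bound: "summable (\<lambda>n. C * \<sigma> powr (- (2 * s)) * k n)"
      by (intro summable_mult k)
    have sm: "summable (\<lambda>n. integral {0<..} (f n))"
      by (rule summable_comparison_test'[OF sm_bound, where N = 0]) (use f_le f_ge in auto)
    have sm_abs: "summable (\<lambda>n. integral {0<..} (\<lambda>x. \<bar>f n x\<bar>))"
    proof -
      have "integral {0<..} (\<lambda>x. \<bar>f n x\<bar>) = integral {0<..} (f n)" for n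
        by (rule integral_cong) (use f_nonneg in auto)
      then show ?thesis using sm by simp
    qed
    have sm_pt: "summable (\<lambda>n. \<bar>f n x\<bar>)" if x: "x \<in> {0<..}" for x
    proof (rule summable_comparison_test'[where N = 0])
      show "summable (\<lambda>n. g x * exp 1 * exp (- 1) ^ n)"
        by (intro summable_mult summable_geometric) simp
      show "norm \<bar>f n x\<bar> \<le> g x * exp 1 * exp (- 1) ^ n" for n
      proof -
        have "exp (1 - real n) = exp 1 * exp (- 1) ^ n"
          by (simp add: exp_of_nat_mult[symmetric] exp_add[symmetric])
        moreover have "exp (- (t n * x\<^sup>2)) * g x \<le> 1 * g x"
          using nonneg x t[of n] by (intro mult_right_mono) (auto simp: less_imp_le)
        moreover from this have "exp (1 - real n) * (exp (- (t n * x\<^sup>2)) * g x) \<le> exp (1 - real n) * (1 * g x)"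
          by (intro mult_left_mono) auto
        ultimately have "f n x \<le> g x * exp 1 * exp (- 1) ^ n"
          by (simp only: f_def mult_ac mult_1)
        then show ?thesis
          using f_nonneg[OF x, of n] by simp
      qed
    qed
    define h where "h x = (\<Sum>n. f n x)" for x
    have h: "(h has_integral (\<Sum>n. integral {0<..} (f n))) {0<..}"
      unfolding h_def by (rule has_integral_suminf(2)[OF f_abs sm_pt sm_abs])
    have le: "norm (exp (- (\<sigma> * x)) * g x) \<le> h x" if x: "x \<in> {0<..}" for x
    proof -
      obtain n where n: "exp (- (\<sigma> * x)) \<le> exp (1 - real n) * exp (- ((1 / (real n + 1))\<^sup>2 * (\<sigma> * x)\<^sup>2))"
        using exp_le_Gaussian_term[of "\<sigma> * x"] \<sigma> x by auto
      have "exp (- (\<sigma> * x)) * g x \<le> exp (1 - real n) * exp (- ((1 / (real n + 1))\<^sup>2 * (\<sigma> * x)\<^sup>2)) * g x"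
        using n nonneg x by (intro mult_right_mono) auto
      also have "\<dots> = f n x"
        by (simp add: f_def t_def power_mult_distrib power_divide mult.assoc)
      also have "\<dots> = sum (\<lambda>n. f n x) {n}" by simp
      also have "\<dots> \<le> h x"
        unfolding h_def using f_nonneg[OF x] summable_rabs_cancel[OF sm_pt[OF x]]
        by (intro sum_le_suminf) auto
      finally show ?thesis using nonneg x by simp
    qed
    have meas: "(\<lambda>x. exp (- (\<sigma> * x)) * g x) \<in> borel_measurable (lebesgue_on {0<..})"
      by (intro continuous_imp_measurable_on_sets_lebesgue continuous_intros cont) auto
    have int_g: "(\<lambda>x. exp (- (\<sigma> * x)) * g x) integrable_on {0<..}"
      using h by (intro measurable_bounded_by_integrable_imp_integrable[OF meas _ le]) auto
    have "(\<lambda>x. exp (- (\<sigma> * x)) * g x) absolutely_integrable_on {0<..}"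
      using int_g nonneg by (intro nonnegative_absolutely_integrable_1) auto
    moreover have "integral {0<..} (\<lambda>x. exp (- (\<sigma> * x)) * g x) \<le> (\<Sum>n. integral {0<..} (f n))"
      by (rule has_integral_le[OF integrable_integral[OF int_g] h]) (use le in force)
    moreover have "(\<Sum>n. integral {0<..} (f n)) \<le> (\<Sum>n. C * \<sigma> powr (- (2 * s)) * k n)"
      by (intro suminf_le f_le sm sm_bound)
    moreover have "(\<Sum>n. C * \<sigma> powr (- (2 * s)) * k n) = C * \<sigma> powr (- (2 * s)) * suminf k"
      by (intro suminf_mult k)
    ultimately show ?thesis
      by (simp add: mult_ac)
  qed
  then show ?thesis by blast
qed

subsection \<open>The Laplace transform and its singularity\<close>

text \<open>About each \<open>p\<close> in the half-plane the kernel is expanded in powers of w - p.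
  Dominated convergence turns the expansion into a convergent power series on the disc of radius Re
  p.\<close>

lemma holomorphic_Laplace:
  fixes g :: "real \<Rightarrow> real"
  assumes cont: "continuous_on {0<..} g"
    and int: "\<And>\<sigma>. 0 < \<sigma> \<Longrightarrow> (\<lambda>x. exp (- (\<sigma> * x)) * g x) absolutely_integrable_on {0<..}"
  shows "(\<lambda>p. integral {0<..} (\<lambda>x. exp (- (p * of_real x)) * complex_of_real (g x))) holomorphic_on {p. 0 < Re p}"
    (is "?L holomorphic_on _")
proof -
  have norm_int: "(\<lambda>x. exp (- (\<sigma> * x)) * \<bar>g x\<bar>) integrable_on {0<..}" if "0 < \<sigma>" for \<sigma>
    using int[OF that] by (simp add: absolutely_integrable_on_def abs_mult)
  have le_exp: "(\<Sum>n<k. v ^ n / fact n) \<le> exp v" if "0 \<le> v" for v :: real and k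
  proof -
    have "(\<Sum>n<k. v ^ n /\<^sub>R fact n) \<le> (\<Sum>n. v ^ n /\<^sub>R fact n)"
      using that by (intro sum_le_suminf summable_exp_generic) auto
    then show ?thesis by (simp add: exp_def divide_inverse mult.commute)
  qed
  have ball: "?L holomorphic_on ball p (Re p)" if p: "0 < Re p" for p
  proof -
    define T where "T n x = (- of_real x) ^ n / fact n * (exp (- (p * of_real x)) * complex_of_real (g x))" for n and x :: real
    have T_int: "T n integrable_on {0<..}" for n
    proof (rule measurable_bounded_by_integrable_imp_integrable)
      show "T n \<in> borel_measurable (lebesgue_on {0<..})"
        unfolding T_def
        by (intro continuous_imp_measurable_on_sets_lebesgue continuous_intros cont) auto
      \<comment> \<open>Half of the exponential decay is spent on absorbing x^n / n!; the other half
        keeps the majorant integrable.\<close>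
      define r where "r = Re p / 2"
      have r: "0 < r" using p by (simp add: r_def)
      show "(\<lambda>x. (1 / r ^ n) * (exp (- (r * x)) * \<bar>g x\<bar>)) integrable_on {0<..}"
        using integrable_on_cmult_left[OF norm_int[OF r], of "1 / r ^ n"] by simp
      show "norm (T n x) \<le> (1 / r ^ n) * (exp (- (r * x)) * \<bar>g x\<bar>)" if x: "x \<in> {0<..}" for x
      proof -
        have "(r * x) ^ n / fact n \<le> (\<Sum>k<Suc n. (r * x) ^ k / fact k)"
          using r x by (intro member_le_sum) auto
        also have "\<dots> \<le> exp (r * x)"
          using r x by (intro le_exp) auto
        finally have "x ^ n / fact n \<le> 1 / r ^ n * exp (r * x)"
          using r by (simp add: power_mult_distrib field_simps)
        then have "x ^ n / fact n * (exp (- (2 * r * x)) * \<bar>g x\<bar>) \<le> 1 / r ^ n * exp (r * x) * (exp (- (2 * r * x)) * \<bar>g x\<bar>)"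
          by (intro mult_right_mono) auto
        also have "\<dots> = 1 / r ^ n * ((exp (r * x) * exp (- (2 * r * x))) * \<bar>g x\<bar>)"
          by simp
        also have "exp (r * x) * exp (- (2 * r * x)) = exp (- (r * x))"
          by (simp flip: exp_add)
        finally show ?thesis
          using x by (simp add: T_def norm_mult norm_divide norm_power r_def)
      qed
    qed auto
    show ?thesis
    proof (rule power_series_holomorphic[where a = "\<lambda>n. integral {0<..} (T n)"])
      fix w assume w: "w \<in> ball p (Re p)"
      define h where "h = w - p"
      \<comment> \<open>All partial sums of the exponential series are bounded by exp(|h| x), which
        leaves the decay rate Re p - |h|, positive on the disc.\<close>
      define \<sigma> where "\<sigma> = Re p - norm h"
      have \<sigma>: "0 < \<sigma>" using w by (simp add: \<sigma>_def h_def dist_norm norm_minus_commute)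
      define F where "F k x = (\<Sum>n<k. h ^ n * T n x)" for k x
      have F_int: "integral {0<..} (F k) = (\<Sum>n<k. integral {0<..} (T n) * h ^ n)" for k
        unfolding F_def
        by (subst integral_sum) (auto intro!: integrable_on_mult_right T_int simp: integral_mult_right mult.commute)
      have F_eq: "F k x = (\<Sum>n<k. (- (h * of_real x)) ^ n /\<^sub>R fact n) * (exp (- (p * of_real x)) * complex_of_real (g x))" for k x
      proof -
        have "h ^ n * T n x = (- (h * of_real x)) ^ n /\<^sub>R fact n * (exp (- (p * of_real x)) * complex_of_real (g x))" for n
          using power_mult_distrib[of h "- of_real x" n]
          by (simp add: T_def scaleR_conv_of_real divide_inverse mult_ac)
        then show ?thesis by (simp add: F_def sum_distrib_right)
      qed
      have "(\<lambda>k. integral {0<..} (F k)) \<longlonglongrightarrow> ?L w"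
      proof (rule dominated_convergence(2)[where h = "\<lambda>x. exp (- (\<sigma> * x)) * \<bar>g x\<bar>"])
        show "F k integrable_on {0<..}" for k
          unfolding F_def by (intro integrable_sum integrable_on_mult_right T_int) auto
        show "(\<lambda>x. exp (- (\<sigma> * x)) * \<bar>g x\<bar>) integrable_on {0<..}"
          by (rule norm_int[OF \<sigma>])
        show "norm (F k x) \<le> exp (- (\<sigma> * x)) * \<bar>g x\<bar>" if x: "x \<in> {0<..}" for k x
        proof -
          have "norm (\<Sum>n<k. (- (h * of_real x)) ^ n /\<^sub>R fact n) \<le> (\<Sum>n<k. (norm h * x) ^ n / fact n)"
            using x by (intro sum_norm_le) (simp add: norm_mult norm_power divide_inverse mult.commute)
          also have "\<dots> \<le> exp (norm h * x)"
            using x by (intro le_exp) auto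
          finally have "norm (F k x) \<le> exp (norm h * x) * (exp (- (Re p * x)) * \<bar>g x\<bar>)"
            unfolding F_eq norm_mult by (intro mult_mono) auto
          also have "\<dots> = (exp (norm h * x) * exp (- (Re p * x))) * \<bar>g x\<bar>"
            by simp
          also have "exp (norm h * x) * exp (- (Re p * x)) = exp (- (\<sigma> * x))"
            by (simp add: \<sigma>_def algebra_simps flip: exp_add)
          finally show ?thesis .
        qed
        show "(\<lambda>k. F k x) \<longlonglongrightarrow> exp (- (w * of_real x)) * complex_of_real (g x)" if "x \<in> {0<..}" for x
        proof -
          have "(\<lambda>k. F k x) \<longlonglongrightarrow> exp (- (h * of_real x)) * (exp (- (p * of_real x)) * complex_of_real (g x))"
            unfolding F_eq using exp_converges[of "- (h * of_real x)"]
            by (intro tendsto_mult tendsto_const) (simp add: sums_def)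
          moreover have "exp (- (h * of_real x)) * exp (- (p * of_real x)) = exp (- (w * of_real x))"
            by (simp add: h_def algebra_simps flip: exp_add)
          ultimately show ?thesis by (simp add: mult.assoc[symmetric])
        qed
      qed
      then show "(\<lambda>n. integral {0<..} (T n) * (w - p) ^ n) sums ?L w"
        by (simp add: sums_def F_int h_def)
    qed
  qed
  show ?thesis
  proof (rule holomorphic_onI)
    fix p :: complex assume "p \<in> {p. 0 < Re p}"
    then have "0 < Re p" by simp
    then have "?L field_differentiable at p"
      using ball by (intro holomorphic_on_imp_differentiable_at[of _ "ball p (Re p)"]) auto
    then show "?L field_differentiable at p within {p. 0 < Re p}"
      by (rule field_differentiable_at_within)
  qed
qed

section \<open>The Gauss series 2F1: Laplace formula and growth near 1\<close>

definition hyp2F1_coeff :: "real \<Rightarrow> real \<Rightarrow> real \<Rightarrow> nat \<Rightarrow> real" where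
  "hyp2F1_coeff a b c n = pochhammer a n * pochhammer b n / (fact n * pochhammer c n)"

lemma summable_hyp2F1_abs:
  assumes "\<bar>z\<bar> < 1"
  shows "summable (\<lambda>n. \<bar>hyp2F1_coeff a b c n * z ^ n\<bar>)"
proof (rule summable_abs_by_ratio)
  show "hyp2F1_coeff a b c (Suc n) * z ^ Suc n =
      ((a + real n) * (b + real n) / ((1 + real n) * (c + real n)) * z) * (hyp2F1_coeff a b c n * z ^ n)" for n
    by (simp add: hyp2F1_coeff_def pochhammer_Suc mult_ac)
  have "(\<lambda>n. (a + real n) * (b + real n) / ((1 + real n) * (c + real n))) \<longlonglongrightarrow> 1"
    by real_asymp
  then show "(\<lambda>n. (a + real n) * (b + real n) / ((1 + real n) * (c + real n)) * z) \<longlonglongrightarrow> z"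
    using tendsto_mult[OF _ tendsto_const[of z]] by fastforce
qed fact

text \<open>The moments contain (2b)_(2n) = 4^n (b)_n (b + 1/2)_n: the 4^n and (b)_n cancel against
  the 1F2 coefficient, and b + 1/2 becomes an upper parameter. The condition \<open>1 < p\<close>
  puts -1/p^2 inside the disc of convergence.\<close>

lemma Laplace_Phi:
  assumes "0 < a" "0 < b" "0 < c" "1 < p"
  shows "((\<lambda>x. exp (- (p * x)) * (x powr (2 * b - 1) * Phi a b c x)) has_integral
     Gamma (2 * b) * p powr (- (2 * b)) * (\<Sum>n. hyp2F1_coeff a (b + 1/2) c n * (- (1 / p\<^sup>2)) ^ n)) {0<..}"
proof -
  define K where "K n = hyp1F2_coeff a b c n * (- 1/4) ^ n" for n
  define I where "I n = Gamma (2 * b + real (2 * n)) / p powr (2 * b + real (2 * n))" for n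
  define A where "A = Gamma (2 * b) * p powr (- (2 * b))"
  define d where "d n = hyp2F1_coeff a (b + 1/2) c n * (- (1 / p\<^sup>2)) ^ n" for n
  have b: "2 * b \<notin> \<int>\<^sub>\<le>\<^sub>0" using assms by (auto elim!: nonpos_Ints_cases)
  have Gb: "0 < Gamma (2 * b)" using assms by (simp add: Gamma_real_pos)
  have p: "0 < p" using assms by simp
  have I: "I n = A * (4 ^ n * pochhammer b n * pochhammer (b + 1/2) n / (p\<^sup>2) ^ n)" for n
  proof -
    have "Gamma (2 * b + real (2 * n)) = Gamma (2 * b) * pochhammer (2 * b) (2 * n)"
      using Gb by (simp add: pochhammer_Gamma[OF b])
    also have "pochhammer (2 * b) (2 * n) = 4 ^ n * pochhammer b n * pochhammer (b + 1/2) n"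
      using pochhammer_double[of b n] by (simp add: power_mult)
    finally have G: "Gamma (2 * b + real (2 * n)) = Gamma (2 * b) * (4 ^ n * pochhammer b n * pochhammer (b + 1/2) n)" .
    have P: "p powr (2 * b + real (2 * n)) = p powr (2 * b) * (p\<^sup>2) ^ n"
      using p powr_realpow[of p "2 * n"] by (simp only: powr_add power_mult)
    show ?thesis
      unfolding I_def A_def G P by (simp only: powr_minus divide_inverse inverse_mult_distrib mult_ac)
  qed
  have KI: "K n * I n = A * d n" for n
  proof -
    have "pochhammer b n \<noteq> 0" using pochhammer_pos[OF assms(2), of n] by simp
    moreover have "(- (1 / p\<^sup>2)) ^ n = (- 1/4) ^ n * 4 ^ n / (p\<^sup>2) ^ n"
    proof -
      have "(- 1/4) ^ n * 4 ^ n = (- 1 :: real) ^ n"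
        by (simp flip: power_mult_distrib)
      then show ?thesis
        using power_divide[of "- 1" "p\<^sup>2" n] by simp
    qed
    ultimately show ?thesis
      by (simp add: K_def I d_def hyp1F2_coeff_def hyp2F1_coeff_def mult_ac)
  qed
  have "0 \<le> I n" for n
    using assms by (simp add: I_def Gamma_real_nonneg)
  then have KI': "\<bar>K n\<bar> * I n = \<bar>A\<bar> * \<bar>d n\<bar>" for n
    using arg_cong[OF KI[of n], of abs] by (simp add: abs_mult)
  have sm: "summable (\<lambda>n. \<bar>d n\<bar>)"
    unfolding d_def using assms(4) one_less_power[of p 2] by (intro summable_hyp2F1_abs) auto
  have "((\<lambda>x. (x powr (2 * b - 1) * exp (- (p * x))) * (\<Sum>n. K n * (x\<^sup>2) ^ n)) has_integral (\<Sum>n. K n * I n)) {0<..}"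
  proof (rule has_integral_powser(2))
    show "((\<lambda>x. x powr (2 * b - 1) * exp (- (p * x)) * (x\<^sup>2) ^ n) has_integral I n) {0<..}" for n
      unfolding I_def
    proof (rule has_integral_eq[rotated, OF has_integral_Gamma_scaled])
      fix x :: real assume "x \<in> {0<..}"
      then have "x powr (2 * b + real (2 * n) - 1) = x powr (2 * b - 1) * (x\<^sup>2) ^ n"
        using powr_realpow[of x "2 * n"] powr_add[of x "2 * b - 1" "real (2 * n)"]
        by (simp add: algebra_simps power_even_eq power_mult[symmetric])
      then show "x powr (2 * b + real (2 * n) - 1) * exp (- (p * x)) = x powr (2 * b - 1) * exp (- (p * x)) * (x\<^sup>2) ^ n"
        by simp
    qed (use assms p in auto)
    show "summable (\<lambda>n. \<bar>K n\<bar> * I n)"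
      unfolding KI' by (intro summable_mult sm)
    show "summable (\<lambda>n. \<bar>K n * (x\<^sup>2) ^ n\<bar>)" for x :: real
      using summable_hyp1F2_abs[OF assms(1-3), of "(- 1/4) * x\<^sup>2"]
      by (simp only: power_mult_distrib K_def mult.assoc)
  qed auto
  moreover have "(\<Sum>n. K n * (x\<^sup>2) ^ n) = Phi a b c x" for x
    using power_mult_distrib[of "- 1/4" "x\<^sup>2"] by (simp add: Phi_def hyp1F2_eq K_def mult.assoc)
  moreover have "(\<Sum>n. K n * I n) = A * (\<Sum>n. d n)"
    unfolding KI by (rule suminf_mult[OF summable_rabs_cancel[OF sm]])
  ultimately show ?thesis
    by (simp add: d_def A_def mult_ac)
qed

text \<open>Gauss's product for Gamma is used for each factor; the powers of n cancel because a + b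
  = c + \<delta>. The shift by one is due to \<open>Gamma_series\<close> containing
  \<open>pochhammer\<close> of length n + 1.\<close>

lemma pochhammer_quotient_tendsto:
  fixes a b c \<delta> :: real
  assumes "0 < a" "0 < b" "0 < c" "0 < \<delta>" "a + b = c + \<delta>"
  shows "(\<lambda>n. pochhammer a n * pochhammer b n / (pochhammer c n * pochhammer \<delta> n))
     \<longlonglongrightarrow> Gamma c * Gamma \<delta> / (Gamma a * Gamma b)"
proof (rule LIMSEQ_offset[of _ 1])
  have "(\<lambda>n. Gamma_series c n * Gamma_series \<delta> n / (Gamma_series a n * Gamma_series b n))
      \<longlonglongrightarrow> Gamma c * Gamma \<delta> / (Gamma a * Gamma b)"
    using assms by (intro tendsto_intros) (simp_all add: Gamma_real_pos less_imp_neq[symmetric])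
  moreover have "Gamma_series c n * Gamma_series \<delta> n / (Gamma_series a n * Gamma_series b n)
      = pochhammer a (n + 1) * pochhammer b (n + 1) / (pochhammer c (n + 1) * pochhammer \<delta> (n + 1))" for n
  proof -
    have "exp (c * ln (real n)) * exp (\<delta> * ln (real n)) = exp (a * ln (real n)) * exp (b * ln (real n))"
      using assms(5) by (simp add: flip: exp_add distrib_right)
    moreover have "pochhammer a (n + 1) \<noteq> 0" "pochhammer b (n + 1) \<noteq> 0" "pochhammer c (n + 1) \<noteq> 0" "pochhammer \<delta> (n + 1) \<noteq> 0"
      using pochhammer_pos[of a "n + 1"] pochhammer_pos[of b "n + 1"] pochhammer_pos[of c "n + 1"]
        pochhammer_pos[of \<delta> "n + 1"] assms by auto
    ultimately show ?thesis
      by (simp add: Gamma_series_def divide_simps)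
  qed
  ultimately show "(\<lambda>n. pochhammer a (n + 1) * pochhammer b (n + 1) / (pochhammer c (n + 1) * pochhammer \<delta> (n + 1)))
      \<longlonglongrightarrow> Gamma c * Gamma \<delta> / (Gamma a * Gamma b)"
    by simp
qed

text \<open>The second form, at the modulus of \<open>z\<close>, is the majorant that will control
  the error between the Gauss series and the first form.\<close>

lemma binomial_series_neg_powr:
  fixes z :: complex and \<delta> :: real
  assumes "norm z < 1"
  shows "(\<lambda>n. of_real (pochhammer \<delta> n / fact n) * z ^ n) sums (1 - z) powr (- of_real \<delta>)"
    and "(\<lambda>n. pochhammer \<delta> n / fact n * norm z ^ n) sums (1 - norm z) powr (- \<delta>)"
proof -
  have "(- 1) ^ n * (- z) ^ n = z ^ n" for n
    using power_mult_distrib[of "- 1" "- z" n] by simp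
  then have "((- of_real \<delta>) gchoose n) * (- z) ^ n = of_real (pochhammer \<delta> n / fact n) * z ^ n" for n
    by (simp add: gbinomial_pochhammer pochhammer_of_real[symmetric] mult_ac)
  then show "(\<lambda>n. of_real (pochhammer \<delta> n / fact n) * z ^ n) sums (1 - z) powr (- of_real \<delta>)"
    using gen_binomial_complex[of "- z" "- of_real \<delta>"] assms by simp
  have "(- 1) ^ n * (- norm z) ^ n = norm z ^ n" for n
    using power_mult_distrib[of "- 1" "- norm z" n] by simp
  then have "((- \<delta>) gchoose n) * (- norm z) ^ n = pochhammer \<delta> n / fact n * norm z ^ n" for n
    by (simp add: gbinomial_pochhammer mult_ac)
  then show "(\<lambda>n. pochhammer \<delta> n / fact n * norm z ^ n) sums (1 - norm z) powr (- \<delta>)"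
    using gen_binomial_real[of "- norm z" "- \<delta>"] assms by simp
qed

lemma summable_hyp2F1_complex:
  fixes z :: complex
  assumes "norm z < 1"
  shows "summable (\<lambda>n. of_real (hyp2F1_coeff a b c n) * z ^ n)"
proof (rule summable_norm_cancel)
  show "summable (\<lambda>n. norm (complex_of_real (hyp2F1_coeff a b c n) * z ^ n))"
    using summable_hyp2F1_abs[of "norm z" a b c] assms by (simp add: norm_mult norm_power abs_mult)
qed

text \<open>The coefficients are asymptotically U times those of (1 - z)^(-\<delta>). Beyond some
  index the relative error is below \<epsilon>, which costs \<epsilon> times the majorant; the
  finitely many earlier terms cost a constant M.\<close>

lemma norm_hyp2F1_lower_bound:
  fixes a b c \<delta> \<epsilon> :: real
  assumes pos: "0 < a" "0 < b" "0 < c" "0 < \<delta>" and sum: "a + b = c + \<delta>" and \<epsilon>: "0 < \<epsilon>"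
  defines "U \<equiv> Gamma c * Gamma \<delta> / (Gamma a * Gamma b)"
  shows "\<exists>M. \<forall>z::complex. norm z < 1 \<longrightarrow>
    U * norm (1 - z) powr (- \<delta>) - \<epsilon> * (1 - norm z) powr (- \<delta>) - M
      \<le> norm (\<Sum>n. of_real (hyp2F1_coeff a b c n) * z ^ n)"
proof -
  define d where "d n = pochhammer \<delta> n / fact n" for n
  define u where "u n = pochhammer a n * pochhammer b n / (pochhammer c n * pochhammer \<delta> n)" for n
  have d: "0 \<le> d n" for n using pos pochhammer_nonneg[of \<delta> n] by (simp add: d_def)
  have q: "hyp2F1_coeff a b c n = u n * d n" for n
    using pochhammer_pos[OF pos(4), of n] by (simp add: hyp2F1_coeff_def u_def d_def)
  have "u \<longlonglongrightarrow> U"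
    unfolding u_def U_def using pos sum by (rule pochhammer_quotient_tendsto)
  then obtain N where N: "\<And>n. n \<ge> N \<Longrightarrow> \<bar>u n - U\<bar> < \<epsilon>"
    using LIMSEQ_D[OF _ \<epsilon>] by (metis real_norm_def)
  define m where "m n = (if n \<in> {..<N} then \<bar>u n - U\<bar> * d n else 0)" for n
  define M where "M = (\<Sum>n<N. \<bar>u n - U\<bar> * d n)"
  have m: "m sums M"
    unfolding m_def M_def by (rule sums_If_finite_set) simp
  have "0 \<le> U" using pos by (simp add: U_def Gamma_real_nonneg)
  have "U * norm (1 - z) powr (- \<delta>) - \<epsilon> * (1 - norm z) powr (- \<delta>) - M
      \<le> norm (\<Sum>n. of_real (hyp2F1_coeff a b c n) * z ^ n)" if z: "norm z < 1" for z :: complex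
  proof -
    let ?H = "\<Sum>n. of_real (hyp2F1_coeff a b c n) * z ^ n"
    let ?P = "of_real U * (1 - z) powr (- of_real \<delta>)"
    have "(\<lambda>n. of_real U * (of_real (d n) * z ^ n)) sums ?P"
      unfolding d_def by (intro sums_mult binomial_series_neg_powr(1) z)
    from sums_diff[OF summable_sums[OF summable_hyp2F1_complex[OF z, of a b c]] this]
    have diff: "(\<lambda>n. of_real ((u n - U) * d n) * z ^ n) sums (?H - ?P)"
      by (simp add: q algebra_simps)
    have bound: "(\<lambda>n. m n + \<epsilon> * (d n * norm z ^ n)) sums (M + \<epsilon> * (1 - norm z) powr (- \<delta>))"
      unfolding d_def by (intro sums_add m sums_mult binomial_series_neg_powr(2) z)
    have norm_term: "norm (of_real ((u n - U) * d n) * z ^ n) = \<bar>u n - U\<bar> * d n * norm z ^ n" for n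
      by (simp only: norm_mult norm_power norm_of_real abs_mult abs_of_nonneg[OF d])
    have "norm (?H - ?P) \<le> M + \<epsilon> * (1 - norm z) powr (- \<delta>)"
    proof (rule norm_sums_le[OF diff bound])
      show "norm (of_real ((u n - U) * d n) * z ^ n) \<le> m n + \<epsilon> * (d n * norm z ^ n)" for n
      proof (cases "n < N")
        case True
        have "\<bar>u n - U\<bar> * d n * norm z ^ n \<le> \<bar>u n - U\<bar> * d n * 1"
          using z d by (intro mult_left_mono power_le_one) auto
        moreover have "0 \<le> \<epsilon> * (d n * norm z ^ n)"
          using \<epsilon> d by simp
        ultimately show ?thesis
          unfolding norm_term using True by (simp add: m_def)
      next
        case False
        then have "\<bar>u n - U\<bar> * (d n * norm z ^ n) \<le> \<epsilon> * (d n * norm z ^ n)"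
          using N[of n] d by (intro mult_right_mono) auto
        then show ?thesis
          unfolding norm_term using False by (simp add: m_def mult.assoc)
      qed
    qed
    moreover have "norm ?P = U * norm (1 - z) powr (- \<delta>)"
      using \<open>0 \<le> U\<close> by (simp add: norm_mult norm_powr_real_powr')
    moreover have "norm ?P \<le> norm ?H + norm (?H - ?P)"
      by (metis norm_minus_commute norm_triangle_sub add.commute)
    ultimately show ?thesis by linarith
  qed
  then show ?thesis by blast
qed

text \<open>The substitution \<open>p = exp w\<close> maps a convex half-strip onto the domain
  \<open>Re p > 0, |p| > 1\<close>, on which the two sides of the Laplace formula are compared.\<close>

lemma Laplace_Phi_complex:
  fixes a b c :: real and p :: complex
  assumes "0 < a" "0 < b" "0 < c"
    and int: "\<And>\<sigma>. 0 < \<sigma> \<Longrightarrow>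
      (\<lambda>x. exp (- (\<sigma> * x)) * (x powr (2 * b - 1) * Phi a b c x)) absolutely_integrable_on {0<..}"
    and p: "0 < Re p" "1 < norm p"
  shows "norm (integral {0<..} (\<lambda>x. exp (- (p * of_real x)) * complex_of_real (x powr (2 * b - 1) * Phi a b c x)))
    = Gamma (2 * b) * norm p powr (- (2 * b)) *
      norm (\<Sum>n. complex_of_real (hyp2F1_coeff a (b + 1/2) c n) * (- (1 / p\<^sup>2)) ^ n)"
proof -
  define g where "g x = x powr (2 * b - 1) * Phi a b c x" for x
  define L where "L p = integral {0<..} (\<lambda>x. exp (- (p * of_real x)) * complex_of_real (g x))" for p
  define H where "H z = (\<Sum>n. complex_of_real (hyp2F1_coeff a (b + 1/2) c n) * z ^ n)" for z
  \<comment> \<open>In the coordinate w the power p^(-2b) becomes the entire function exp(-2 b w),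
    so no choice of branch arises.\<close>
  define R where "R w = of_real (Gamma (2 * b)) * exp (- (of_real (2 * b) * w)) * H (- exp (- (2 * w)))" for w
  define W where "W = {w. 0 < Re w} \<inter> ({w. Im w < pi / 2} \<inter> {w. - (pi / 2) < Im w})"
  have cont: "continuous_on {0<..} g"
    unfolding g_def using continuous_on_Phi[OF assms(1-3)] by (intro continuous_intros) auto
  have L_hol: "L holomorphic_on {p. 0 < Re p}"
    unfolding L_def by (rule holomorphic_Laplace[OF cont]) (use int in \<open>simp add: g_def\<close>)
  have H_hol: "H holomorphic_on ball 0 1"
  proof (rule power_series_holomorphic)
    fix z :: complex assume "z \<in> ball 0 1"
    then show "(\<lambda>n. of_real (hyp2F1_coeff a (b + 1/2) c n) * (z - 0) ^ n) sums H z"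
      unfolding H_def using summable_hyp2F1_complex[of z a "b + 1/2" c] by (simp add: summable_sums)
  qed
  have W_open: "open W" and W_conn: "connected W"
    unfolding W_def
    by (intro open_Int open_halfspace_Re_gt open_halfspace_Im_lt open_halfspace_Im_gt)
       (intro convex_connected convex_Int convex_halfspace_Re_gt convex_halfspace_Im_lt convex_halfspace_Im_gt)
  have "(\<lambda>w. L (exp w)) holomorphic_on W"
  proof (rule holomorphic_on_compose_gen[OF _ L_hol, unfolded o_def])
    show "exp ` W \<subseteq> {p. 0 < Re p}"
      by (auto simp: W_def Re_exp cos_gt_zero_pi)
  qed (intro holomorphic_intros)
  moreover have "(\<lambda>w. H (- exp (- (2 * w)))) holomorphic_on W"
  proof (rule holomorphic_on_compose_gen[OF _ H_hol, unfolded o_def])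
    show "(\<lambda>w. - exp (- (2 * w))) ` W \<subseteq> ball 0 1"
      by (auto simp: W_def)
  qed (intro holomorphic_intros)
  ultimately have hol: "(\<lambda>w. L (exp w) - R w) holomorphic_on W"
    unfolding R_def by (intro holomorphic_intros)
  have real_axis: "L (exp w) - R w = 0" if w: "w \<in> complex_of_real ` {0<..}" for w
  proof -
    obtain r where r: "0 < r" "w = of_real r" using w by auto
    define q where "q = exp r"
    have q: "1 < q" using r by (simp add: q_def)
    have "((\<lambda>x. complex_of_real (exp (- (q * x)) * g x)) has_integral
        of_real (Gamma (2 * b) * q powr (- (2 * b)) * (\<Sum>n. hyp2F1_coeff a (b + 1/2) c n * (- (1 / q\<^sup>2)) ^ n))) {0<..}"
      using has_integral_linear[OF Laplace_Phi[OF assms(1-3) q] bounded_linear_of_real]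
      by (simp add: o_def g_def)
    then have "L (of_real q) = of_real (Gamma (2 * b) * q powr (- (2 * b)) * (\<Sum>n. hyp2F1_coeff a (b + 1/2) c n * (- (1 / q\<^sup>2)) ^ n))"
      unfolding L_def by (intro integral_unique) (simp add: exp_of_real flip: of_real_mult of_real_minus)
    moreover have "complex_of_real (\<Sum>n. hyp2F1_coeff a (b + 1/2) c n * (- (1 / q\<^sup>2)) ^ n) = H (of_real (- (1 / q\<^sup>2)))"
    proof -
      have "1 < q\<^sup>2" using q by (simp add: one_less_power)
      then have "\<bar>- (1 / q\<^sup>2)\<bar> < 1" by (simp add: divide_less_eq)
      then have "summable (\<lambda>n. hyp2F1_coeff a (b + 1/2) c n * (- (1 / q\<^sup>2)) ^ n)"
        by (rule summable_rabs_cancel[OF summable_hyp2F1_abs])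
      from suminf_of_real[OF this, where 'a = complex] show ?thesis
        unfolding H_def by (simp only: of_real_mult of_real_power)
    qed
    moreover have "of_real (- (1 / q\<^sup>2)) = - exp (- (2 * w))"
      by (simp add: q_def r exp_minus exp_double exp_of_real divide_inverse)
    moreover have "complex_of_real (q powr (- (2 * b))) = exp (- (of_real (2 * b) * w))"
      by (simp add: q_def r powr_def exp_of_real[symmetric])
    moreover have "exp w = of_real q"
      by (simp add: q_def r exp_of_real)
    ultimately show ?thesis by (simp add: R_def)
  qed
  \<comment> \<open>The identity holds for real w > 0 by \<open>Laplace_Phi\<close>, and these
    points accumulate at 1 inside \<open>W\<close>, so it extends to all of
    \<open>W\<close>.\<close>
  have main: "L (exp w) - R w = 0" if "w \<in> W" for w
  proof (rule analytic_continuation[OF hol W_open W_conn])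
    show "complex_of_real ` {0<..} \<subseteq> W" by (auto simp: W_def)
    show "1 \<in> W" by (auto simp: W_def)
    show "1 islimpt complex_of_real ` {0<..}"
      unfolding islimpt_approachable
    proof (intro allI impI)
      fix e :: real assume e: "0 < e"
      show "\<exists>x'\<in>complex_of_real ` {0<..}. x' \<noteq> 1 \<and> dist x' 1 < e"
      proof (intro bexI conjI)
        show "complex_of_real (1 + e/2) \<in> complex_of_real ` {0<..}"
          using e by (intro imageI) simp
      qed (use e in \<open>simp_all add: dist_norm norm_divide\<close>)
    qed
  qed (use real_axis that in auto)
  define w where "w = Ln p"
  have "p \<noteq> 0" using p by auto
  then have w: "exp w = p" "Re w = ln (norm p)" by (auto simp: w_def)
  have "\<bar>Im w\<bar> < pi / 2"
    unfolding w_def using Re_Ln_pos_lt[OF \<open>p \<noteq> 0\<close>] p by simp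
  moreover have "0 < Re w"
    using ln_gt_zero[OF p(2)] by (simp only: w(2))
  ultimately have "w \<in> W"
    unfolding W_def Int_iff mem_Collect_eq by linarith
  from main[OF this] have "L p = R w"
    by (simp add: w(1))
  moreover have "exp (- (2 * w)) = 1 / p\<^sup>2"
    using w(1) by (simp add: exp_minus exp_double divide_inverse)
  moreover have "norm (exp (- (of_real (2 * b) * w))) = norm p powr (- (2 * b))"
    using w(2) \<open>p \<noteq> 0\<close> by (simp add: powr_def)
  moreover have "0 \<le> Gamma (2 * b)" using assms by (simp add: Gamma_real_nonneg)
  ultimately show ?thesis
    by (simp add: R_def L_def g_def H_def norm_mult)
qed

text \<open>With s = b - a and \<delta> = a + b + 1/2 - c, failure of the claim means 2s < \<delta>.
  Then growth of order \<sigma>^(-\<delta>) near the singularity exceeds the bound of order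
  \<sigma>^(-2s) on the real axis.\<close>

lemma three_a_half_le_of_Phi_nonneg:
  fixes a b c :: real
  assumes "0 < a" "a < b" "a < c" and nonneg: "\<And>x. 0 < x \<Longrightarrow> 0 \<le> Phi a b c x"
  shows "3 * a + 1/2 \<le> b + c"
proof (rule ccontr)
  assume "\<not> ?thesis"
  then have less: "b + c < 3 * a + 1/2" by simp
  have pos: "0 < a" "0 < b" "0 < c" using assms by auto
  define s where "s = b - a"
  define \<delta> where "\<delta> = a + (b + 1/2) - c"
  have s: "0 < s" and \<delta>: "2 * s < \<delta>" "0 < \<delta>"
    using assms less by (auto simp: s_def \<delta>_def)
  define g where "g x = x powr (2 * b - 1) * Phi a b c x" for x
  have g_nonneg: "0 \<le> g x" if "0 < x" for x
    using nonneg that by (simp add: g_def)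
  have g_cont: "continuous_on {0<..} g"
    unfolding g_def using continuous_on_Phi[OF pos] by (intro continuous_intros) auto
  obtain C where "\<And>t. 0 < t \<Longrightarrow> (\<lambda>x. exp (- (t * x\<^sup>2)) * g x) integrable_on {0<..}"
      "\<And>t. 0 < t \<Longrightarrow> integral {0<..} (\<lambda>x. exp (- (t * x\<^sup>2)) * g x) \<le> C * t powr (- s)"
    using Phi_Gaussian_bound[OF pos(1,2) assms(3)] unfolding g_def s_def by auto
  from Laplace_bound_of_Gaussian_bound[OF s g_cont g_nonneg this]
  obtain K where int: "\<And>\<sigma>. 0 < \<sigma> \<Longrightarrow> (\<lambda>x. exp (- (\<sigma> * x)) * g x) absolutely_integrable_on {0<..}"
    and K: "\<And>\<sigma>. 0 < \<sigma> \<Longrightarrow> integral {0<..} (\<lambda>x. exp (- (\<sigma> * x)) * g x) \<le> K * \<sigma> powr (- (2 * s))"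
    by blast
  define U where "U = Gamma c * Gamma \<delta> / (Gamma a * Gamma (b + 1/2))"
  have U: "0 < U" using pos \<delta> by (simp add: U_def Gamma_real_pos)
  \<comment> \<open>Along the path chosen below, |1 - z| <= 4 \<sigma> and 1 - |z| >= \<sigma>. The
    main term is then at least 2 \<epsilon> \<sigma>^(-\<delta>) and the error at most \<epsilon>
    \<sigma>^(-\<delta>), so half of the main term survives.\<close>
  define \<epsilon> where "\<epsilon> = U * 4 powr (- \<delta>) / 2"
  have \<epsilon>: "0 < \<epsilon>" using U by (simp add: \<epsilon>_def)
  obtain M where M: "\<And>z::complex. norm z < 1 \<Longrightarrow>
      U * norm (1 - z) powr (- \<delta>) - \<epsilon> * (1 - norm z) powr (- \<delta>) - M
      \<le> norm (\<Sum>n. of_real (hyp2F1_coeff a (b + 1/2) c n) * z ^ n)"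
  proof -
    have "0 < b + 1/2" "a + (b + 1/2) = c + \<delta>"
      using pos by (simp_all add: \<delta>_def)
    from norm_hyp2F1_lower_bound[OF pos(1) this(1) pos(3) \<delta>(2) this(2) \<epsilon>] show ?thesis
      unfolding U_def[symmetric] using that by blast
  qed
  \<comment> \<open>A lower bound for the Laplace prefactor, valid because |p| <= 2 on the
    path.\<close>
  define A where "A = Gamma (2 * b) * 2 powr (- (2 * b))"
  have A: "0 < A" using pos by (simp add: A_def Gamma_real_pos)
  have ineq: "A * \<epsilon> \<le> A * M * \<sigma> powr \<delta> + K * \<sigma> powr (\<delta> - 2 * s)" if \<sigma>: "0 < \<sigma>" "\<sigma> < 1/2" for \<sigma>
  proof -
    \<comment> \<open>As \<open>\<sigma>\<close> tends to 0, \<open>p\<close> approaches the singularity \<open>\<i>\<close> in such a way that \<open>z\<close> tends to 1 non-tangentially.\<close>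
    define p where "p = Complex \<sigma> (1 + \<sigma>)"
    define z where "z = - (1 / p\<^sup>2)"
    have norm2: "(norm p)\<^sup>2 = \<sigma>\<^sup>2 + (1 + \<sigma>)\<^sup>2"
      by (simp add: p_def cmod_power2)
    have "1 + 2 * \<sigma> \<le> (norm p)\<^sup>2"
      unfolding norm2 by (simp add: power2_eq_square algebra_simps)
    then have p1: "1 < norm p"
      using \<sigma> by (intro power2_less_imp_less[of 1 "norm p"]) auto
    have p2: "norm p \<le> 2"
      using cmod_le[of p] \<sigma> by (simp add: p_def)
    have p0: "p \<noteq> 0" using p1 by auto
    have nz: "norm z = 1 / (norm p)\<^sup>2"
      by (simp add: z_def norm_divide norm_power)
    have "1 / (norm p)\<^sup>2 \<le> 1 / (1 + 2 * \<sigma>)"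
      using \<sigma> \<open>1 + 2 * \<sigma> \<le> (norm p)\<^sup>2\<close> by (intro frac_le) auto
    \<comment> \<open>After clearing denominators this is \<sigma> - 2 \<sigma>^2 >= 0, which holds
      as \<sigma> < 1/2.\<close>
    also have "1 / (1 + 2 * \<sigma>) \<le> 1 - \<sigma>"
      using \<sigma> by (simp add: divide_simps algebra_simps power2_eq_square)
    finally have z1: "\<sigma> \<le> 1 - norm z"
      using nz by simp
    have z2: "norm (1 - z) \<le> 4 * \<sigma>"
    proof -
      have "1 - z = (p - \<i>) * (p + \<i>) / p\<^sup>2"
        using p0 by (simp add: z_def field_simps power2_eq_square)
      then have "norm (1 - z) = norm (p - \<i>) * norm (p + \<i>) / (norm p)\<^sup>2"
        by (simp add: norm_mult norm_divide norm_power)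
      also have "\<dots> \<le> (2 * \<sigma>) * (2 * (norm p)\<^sup>2) / (norm p)\<^sup>2"
      proof (intro divide_right_mono mult_mono)
        show "norm (p - \<i>) \<le> 2 * \<sigma>"
          using cmod_le[of "p - \<i>"] \<sigma> by (simp add: p_def)
        have "norm (p + \<i>) \<le> norm p + 1"
          using norm_triangle_ineq[of p \<i>] by simp
        also have "norm p + 1 \<le> 2 * (norm p)\<^sup>2"
          using p1 power_increasing[of 1 2 "norm p"] by simp
        finally show "norm (p + \<i>) \<le> 2 * (norm p)\<^sup>2" .
      qed (use \<sigma> in auto)
      finally show ?thesis using p0 by simp
    qed
    have z3: "norm z < 1" using z1 \<sigma> by simp
    then have "z \<noteq> 1" by auto
    have "U * (4 * \<sigma>) powr (- \<delta>) \<le> U * norm (1 - z) powr (- \<delta>)"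
      using U z2 \<sigma> \<delta> \<open>z \<noteq> 1\<close> by (intro mult_left_mono powr_mono2') auto
    moreover have "\<epsilon> * (1 - norm z) powr (- \<delta>) \<le> \<epsilon> * \<sigma> powr (- \<delta>)"
      using \<epsilon> z1 \<sigma> \<delta> by (intro mult_left_mono powr_mono2') auto
    moreover have "U * (4 * \<sigma>) powr (- \<delta>) = 2 * \<epsilon> * \<sigma> powr (- \<delta>)"
      using \<sigma> by (simp add: \<epsilon>_def powr_mult)
    ultimately have H: "\<epsilon> * \<sigma> powr (- \<delta>) - M \<le> norm (\<Sum>n. of_real (hyp2F1_coeff a (b + 1/2) c n) * z ^ n)"
      using M[OF z3] by linarith
    have "A * (\<epsilon> * \<sigma> powr (- \<delta>) - M) \<le> A * norm (\<Sum>n. of_real (hyp2F1_coeff a (b + 1/2) c n) * z ^ n)"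
      using H A by (intro mult_left_mono) auto
    also have "\<dots> \<le> Gamma (2 * b) * norm p powr (- (2 * b)) * norm (\<Sum>n. of_real (hyp2F1_coeff a (b + 1/2) c n) * z ^ n)"
      unfolding A_def using pos p0 p2
      by (intro mult_right_mono mult_left_mono powr_mono2') (auto simp: Gamma_real_nonneg)
    also have "\<dots> = norm (integral {0<..} (\<lambda>x. exp (- (p * of_real x)) * complex_of_real (g x)))"
      unfolding g_def z_def
      by (rule Laplace_Phi_complex[symmetric, OF pos]) (use int \<sigma> p1 in \<open>auto simp: g_def p_def\<close>)
    also have "\<dots> \<le> integral {0<..} (\<lambda>x. exp (- (\<sigma> * x)) * g x)"
    proof (rule integral_norm_bound_integral')
      show "norm (exp (- (p * of_real x)) * complex_of_real (g x)) \<le> exp (- (\<sigma> * x)) * g x" if "x \<in> {0<..}" for x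
        using that g_nonneg by (simp add: norm_mult p_def)
      show "(\<lambda>x. exp (- (p * of_real x)) * complex_of_real (g x)) \<in> borel_measurable (lebesgue_on {0<..})"
        by (intro continuous_imp_measurable_on_sets_lebesgue continuous_intros g_cont) auto
      show "((\<lambda>x. exp (- (\<sigma> * x)) * g x) has_integral integral {0<..} (\<lambda>x. exp (- (\<sigma> * x)) * g x)) {0<..}"
        using int[OF \<sigma>(1)] by (intro integrable_integral) (simp add: absolutely_integrable_on_def)
    qed auto
    also have "\<dots> \<le> K * \<sigma> powr (- (2 * s))"
      by (rule K[OF \<sigma>(1)])
    finally have "A * (\<epsilon> * \<sigma> powr (- \<delta>) - M) * \<sigma> powr \<delta> \<le> K * \<sigma> powr (- (2 * s)) * \<sigma> powr \<delta>"
      by (intro mult_right_mono) auto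
    moreover have "\<sigma> powr (- (2 * s)) * \<sigma> powr \<delta> = \<sigma> powr (\<delta> - 2 * s)"
      by (simp flip: powr_add)
    moreover have "\<sigma> powr (- \<delta>) * \<sigma> powr \<delta> = 1"
      using \<sigma> by (simp flip: powr_add)
    ultimately show ?thesis
      by (simp add: algebra_simps)
  qed
  have powr_0: "((\<lambda>\<sigma>::real. \<sigma> powr e) \<longlongrightarrow> 0) (at_right 0)" if "0 < e" for e :: real
    using that by real_asymp
  \<comment> \<open>Both exponents are positive, so the right side of \<open>ineq\<close> tends to 0
    while its left side is a fixed positive number.\<close>
  have "((\<lambda>\<sigma>. A * M * \<sigma> powr \<delta> + K * \<sigma> powr (\<delta> - 2 * s)) \<longlongrightarrow> A * M * 0 + K * 0) (at_right 0)"
    using \<delta> by (intro tendsto_intros powr_0) auto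
  moreover have "eventually (\<lambda>\<sigma>. A * \<epsilon> \<le> A * M * \<sigma> powr \<delta> + K * \<sigma> powr (\<delta> - 2 * s)) (at_right 0)"
  proof (rule eventually_mono)
    show "eventually (\<lambda>\<sigma>. \<sigma> \<in> {0<..<1/2}) (at_right (0::real))"
      by (rule eventually_at_right_real) simp
  qed (use ineq in simp)
  ultimately have "A * \<epsilon> \<le> A * M * 0 + K * 0"
    by (intro tendsto_lowerbound) auto
  then show False using A \<epsilon> by (simp add: mult_le_0_iff)
qed

theorem theorem1:
  fixes a b c :: real
  assumes "a > 0" and "b > 0" and "c > 0"
  shows "((a, b, c) \<in> P12 \<longrightarrow> b > a \<and> c > a \<and> b + c \<ge> 3 * a + 1 / 2)
    \<and> (b \<le> a \<longrightarrow> alternates (Phi a b c) \<and>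
          (\<exists>x. 0 < x \<and> x \<le> bessel_zero (c - 1) \<and> Phi a b c x = 0))
    \<and> (c \<le> a \<longrightarrow> alternates (Phi a b c) \<and>
          (\<exists>x. 0 < x \<and> x \<le> bessel_zero (b - 1) \<and> Phi a b c x = 0))
    \<and> ((b \<le> a + 1 / 2 \<and> c \<le> 2 * a \<or> b \<le> 2 * a \<and> c \<le> a + 1 / 2) \<and> b + c < 3 * a + 1 / 2
        \<longrightarrow> alternates (Phi a b c) \<and>
          (\<exists>x. 0 < x \<and> x < 2 * bessel_zero (a - 1 / 2) \<and> Phi a b c x = 0))"
proof -
  have i: "alternates (Phi a b c) \<and> (\<exists>x. 0 < x \<and> x \<le> bessel_zero (c - 1) \<and> Phi a b c x = 0)" if "b \<le> a"
    using Phi_alternates_le[OF assms that] .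
  have i': "alternates (Phi a b c) \<and> (\<exists>x. 0 < x \<and> x \<le> bessel_zero (b - 1) \<and> Phi a b c x = 0)" if "c \<le> a"
    using Phi_alternates_le[OF assms(1,3,2) that] unfolding Phi_commute[of a c b] .
  have ii: "alternates (Phi a b c) \<and> (\<exists>x. 0 < x \<and> x < 2 * bessel_zero (a - 1 / 2) \<and> Phi a b c x = 0)"
    if "b \<le> a + 1 / 2 \<and> c \<le> 2 * a \<or> b \<le> 2 * a \<and> c \<le> a + 1 / 2" "b + c < 3 * a + 1 / 2"
    using that(1)
  proof
    assume "b \<le> a + 1 / 2 \<and> c \<le> 2 * a"
    then show ?thesis
      using Phi_alternates_below_square[OF assms _ _ that(2)] by blast
  next
    assume *: "b \<le> 2 * a \<and> c \<le> a + 1 / 2"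
    have "c + b < 3 * a + 1 / 2" using that(2) by simp
    then show ?thesis
      using * Phi_alternates_below_square[OF assms(1,3,2)] unfolding Phi_commute[of a c b] by blast
  qed
  have "b > a \<and> c > a \<and> b + c \<ge> 3 * a + 1 / 2" if "(a, b, c) \<in> P12"
  proof -
    have pos: "0 < Phi a b c x" if "0 < x" for x
      using \<open>(a, b, c) \<in> P12\<close> that by (simp add: P12_def)
    then have "\<not> alternates (Phi a b c)"
      unfolding alternates_def by (meson less_asym)
    \<comment> \<open>The contrapositives of (i). They are then hypotheses of the last inequality:
      \<open>a < c\<close> is used for Euler's integral for 1F1, and \<open>a < b\<close> makes the
      exponent b - a positive.\<close>
    then have "a < b" "a < c"
      using i i' by (meson not_less)+
    moreover from this have "3 * a + 1 / 2 \<le> b + c"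
      using assms pos by (intro three_a_half_le_of_Phi_nonneg) (auto simp: less_imp_le)
    ultimately show ?thesis by simp
  qed
  then show ?thesis
    using i i' ii by blast
qed

end
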